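(* Let $p,s,r$ be integers with $1\le r\le s\le p$, let $n\in\mathbb{N}$, $\lambda>0$, and let $\mathbf{X}$ be generated by the spiked model with $\sigma=1$. There is an absolute constant $c>0$ such that \[ \inf_{\widehat{\mathbf{V}}}\ \sup_{\boldsymbol{\Sigma}\in\Theta_0(s,p,r,\lambda)} \mathsf{E}\bigl\|\widehat{\mathbf{V}}\widehat{\mathbf{V}}'-\mathbf{V}\mathbf{V}'\bigr\|_{\mathrm F}^2\ \ge\ c\left(\left[\frac{1}{nh(\lambda)}\Bigl(r(s-r)+(s-r)\log\frac{\mathrm{e}(p-r)}{s-r}\Bigr)\right]\wedge 1\right), \] where the infimum is over all estimators $\widehat{\mathbf{V}}$ (measurable functions of $\mathbf{X}$ with values in $O(p,r)$), and the term $(s-r)\log\frac{\mathrm{e}(p-r)}{s-r}$ is interpreted as $0$ when $s=r$.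
   Context: Spiked model: $\mathbf{X}=\mathbf{U}\mathbf{D}\mathbf{V}'+\mathbf{Z}$ is $n\times p$, where $\mathbf{U}$ is $n\times r$ with i.i.d. $N(0,1)$ entries, $\mathbf{D}=\operatorname{diag}(\lambda_1^{1/2},\dots,\lambda_r^{1/2})$, $\mathbf{V}\in O(p,r)=\{\mathbf{V}\in\mathbb{R}^{p\times r}:\mathbf{V}'\mathbf{V}=\mathbf{I}_r\}$, and $\mathbf{Z}$ has i.i.d. $N(0,\sigma^2)$ entries independent of $\mathbf{U}$; equivalently the rows of $\mathbf{X}$ are i.i.d. $N(0,\boldsymbol{\Sigma})$ with $\boldsymbol{\Sigma}=\mathbf{V}\boldsymbol{\Lambda}\mathbf{V}'+\sigma^2\mathbf{I}_p$, $\boldsymbol{\Lambda}=\operatorname{diag}(\lambda_1,\dots,\lambda_r)$. Fix a constant $\kappa>1$. Parameter space: $\Theta_0(s,p,r,\lambda)=\{\boldsymbol{\Sigma}=\mathbf{V}\boldsymbol{\Lambda}\mathbf{V}'+\mathbf{I}_p: 0<\lambda\le\lambda_r\le\dots\le\lambda_1\le\kappa\lambda,\ \mathbf{V}\in O(p,r),\ \mathbf{V}\text{ has at most } s \text{ nonzero rows}\}$. $h(\lambda)=\lambda^2/(\lambda+1)$. *)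

theory Defs
  imports "HOL-Probability.Probability"
begin

text \<open>Matrices are functions nat => nat => real; only the indices below the
stated dimensions are relevant.\<close>

definition std_gauss :: "real measure" where
  "std_gauss = density lborel (\<lambda>x. ennreal (std_normal_density x))"

definition orth_frame :: "nat \<Rightarrow> nat \<Rightarrow> (nat \<Rightarrow> nat \<Rightarrow> real) \<Rightarrow> bool" where
  "orth_frame p r V \<longleftrightarrow>
     (\<forall>j<r. \<forall>k<r. (\<Sum>i<p. V i j * V i k) = (if j = k then 1 else 0))"

definition nz_rows :: "nat \<Rightarrow> nat \<Rightarrow> (nat \<Rightarrow> nat \<Rightarrow> real) \<Rightarrow> nat" where
  "nz_rows p r V = card {i. i < p \<and> (\<exists>j<r. V i j \<noteq> 0)}"

text \<open>Parameter space Theta_0(s,p,r,lambda) (with sigma = 1), parametrised by the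
pair (V, Lambda), Lambda = diag(lam 0, ..., lam (r-1)), lam 0 the largest.\<close>
definition Theta0 :: "real \<Rightarrow> nat \<Rightarrow> nat \<Rightarrow> nat \<Rightarrow> real \<Rightarrow>
    ((nat \<Rightarrow> nat \<Rightarrow> real) \<times> (nat \<Rightarrow> real)) set" where
  "Theta0 \<kappa> s p r lmb = {(V, lam).
      orth_frame p r V \<and> nz_rows p r V \<le> s \<and>
      (\<forall>j<r. lmb \<le> lam j \<and> lam j \<le> \<kappa> * lmb) \<and>
      (\<forall>j k. j \<le> k \<longrightarrow> k < r \<longrightarrow> lam k \<le> lam j)}"

definition proj_dist2 :: "nat \<Rightarrow> nat \<Rightarrow> (nat \<Rightarrow> nat \<Rightarrow> real) \<Rightarrow> (nat \<Rightarrow> nat \<Rightarrow> real) \<Rightarrow> real" where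
  "proj_dist2 p r A B =
     (\<Sum>i<p. \<Sum>k<p. ((\<Sum>j<r. A i j * A k j) - (\<Sum>j<r. B i j * B k j))\<^sup>2)"

definition noise_space :: "nat \<Rightarrow> nat \<Rightarrow> nat \<Rightarrow> ((nat \<times> nat \<Rightarrow> real) \<times> (nat \<times> nat \<Rightarrow> real)) measure" where
  "noise_space n p r =
     (PiM ({..<n} \<times> {..<r}) (\<lambda>_. std_gauss)) \<Otimes>\<^sub>M (PiM ({..<n} \<times> {..<p}) (\<lambda>_. std_gauss))"

definition data_space :: "nat \<Rightarrow> nat \<Rightarrow> (nat \<times> nat \<Rightarrow> real) measure" where
  "data_space n p = PiM ({..<n} \<times> {..<p}) (\<lambda>_. borel)"

text \<open>Spiked model X = U D V' + Z with sigma = 1, D = diag(sqrt lam).\<close>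
definition spiked_X :: "nat \<Rightarrow> nat \<Rightarrow> nat \<Rightarrow> (nat \<Rightarrow> nat \<Rightarrow> real) \<Rightarrow> (nat \<Rightarrow> real) \<Rightarrow>
    (nat \<times> nat \<Rightarrow> real) \<times> (nat \<times> nat \<Rightarrow> real) \<Rightarrow> (nat \<times> nat \<Rightarrow> real)" where
  "spiked_X n p r V lam \<omega> = (\<lambda>(i, k).
     if i < n \<and> k < p then (\<Sum>j<r. fst \<omega> (i, j) * sqrt (lam j) * V k j) + snd \<omega> (i, k)
     else undefined)"

definition estimators :: "nat \<Rightarrow> nat \<Rightarrow> nat \<Rightarrow> ((nat \<times> nat \<Rightarrow> real) \<Rightarrow> nat \<Rightarrow> nat \<Rightarrow> real) set" where
  "estimators n p r = {Vh.
      (\<forall>x \<in> space (data_space n p). orth_frame p r (Vh x)) \<and>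
      (\<forall>i j. (\<lambda>x. Vh x i j) \<in> borel_measurable (data_space n p))}"

definition risk :: "nat \<Rightarrow> nat \<Rightarrow> nat \<Rightarrow> ((nat \<times> nat \<Rightarrow> real) \<Rightarrow> nat \<Rightarrow> nat \<Rightarrow> real) \<Rightarrow>
    (nat \<Rightarrow> nat \<Rightarrow> real) \<Rightarrow> (nat \<Rightarrow> real) \<Rightarrow> real" where
  "risk n p r Vh V lam =
     (\<integral>\<omega>. proj_dist2 p r (Vh (spiked_X n p r V lam \<omega>)) V \<partial>(noise_space n p r))"

definition hfun :: "real \<Rightarrow> real" where
  "hfun lmb = lmb\<^sup>2 / (lmb + 1)"

end

theory Submission
  imports Defs
begin

text \<open>Take \<open>\<Lambda> = \<lambda> I\<close> and let \<open>V\<close> be an orthonormal basis of the column space of \<open>[I; M]\<close> for a small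
\<open>(p - r) \<times> r\<close> matrix \<open>M\<close>. Then the relative entropy between two such models is
\<open>n h(\<lambda>)/4\<close> times the squared Frobenius distance of the projections, which is at most
\<open>2 |M - M'|\<^sup>2\<close>, while entries of the lower left block of the projections differ by
almost as much as the entries of \<open>M\<close> and \<open>M'\<close>. Hence Assouad's scheme applies with a Fano-type
\<open>B\<close>-ary test in every coordinate. The term \<open>r(s - r)\<close> comes from letting all entries of
\<open>s - r\<close> rows of \<open>M\<close> range over a grid; the logarithmic term comes from one column of \<open>M\<close> that
has exactly one nonzero entry in each of \<open>s - r\<close> blocks of length \<open>(p - r) div (s - r)\<close>.
When these blocks are short, the first term dominates.

No Gaussian determinants are needed: integrating out \<open>U\<close> gives the density
\<open>(1 + \<lambda>)^(-nr/2) exp(\<lambda>/(2(1 + \<lambda>)) |XV|\<^sup>2)\<close> of \<open>X\<close> with respect to the law of \<open>Z\<close>.\<close>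

subsection \<open>Orthonormal frames and graphs of matrices\<close>

text \<open>The bound has to grow with the number of free parameters, while loss and relative
  entropy are global quantities. A packing of the whole parameter set would require a counting
  argument. Splitting by coordinates only requires that two values of one coordinate, all others
  being fixed, can be told apart on entries of the projection reserved for that coordinate. Such
  entries exist because |M|^2 \<le> 1/64 makes the map from M to the projection nearly linear; the
  same restriction is the source of the truncation at 1. Tests with B alternatives are there for the
  logarithm: they tolerate relative entropy of order ln B, a binary test only a constant. Each test
  compares all alternatives with a single reference hypothesis, so no mutual information appears.
  Equal spikes keep the constant free of \<kappa>.\<close>

definition projm :: "nat \<Rightarrow> (nat \<Rightarrow> nat \<Rightarrow> real) \<Rightarrow> nat \<Rightarrow> nat \<Rightarrow> real" where
  "projm r V i k = (\<Sum>l<r. V i l * V k l)"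

lemma proj_dist2_projm:
  "proj_dist2 p r A B = (\<Sum>i<p. \<Sum>k<p. (projm r A i k - projm r B i k)\<^sup>2)"
  by (simp add: proj_dist2_def projm_def)

text \<open>Both sides are the trace of AA'BB'. The right-hand form, the squared norm of A'B, is
  also what the Gaussian expectations produce, so loss and relative entropy become
  comparable.\<close>

lemma sum_projm_mult:
  "(\<Sum>i<p. \<Sum>k<p. projm r A i k * projm r B i k) = (\<Sum>j<r. \<Sum>l<r. (\<Sum>i<p. A i j * B i l)\<^sup>2)"
proof -
  have "(\<Sum>j<r. \<Sum>l<r. (\<Sum>i<p. A i j * B i l)\<^sup>2)
      = (\<Sum>j<r. \<Sum>l<r. \<Sum>i<p. \<Sum>k<p. (A i j * A k j) * (B i l * B k l))"
    by (simp add: power2_eq_square sum_product mult_ac)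
  also have "\<dots> = (\<Sum>j<r. \<Sum>i<p. \<Sum>l<r. \<Sum>k<p. (A i j * A k j) * (B i l * B k l))"
    by (rule sum.cong[OF refl]) (rule sum.swap)
  also have "\<dots> = (\<Sum>i<p. \<Sum>j<r. \<Sum>l<r. \<Sum>k<p. (A i j * A k j) * (B i l * B k l))"
    by (rule sum.swap)
  also have "\<dots> = (\<Sum>i<p. \<Sum>j<r. \<Sum>k<p. \<Sum>l<r. (A i j * A k j) * (B i l * B k l))"
    by (rule sum.cong[OF refl], rule sum.cong[OF refl]) (rule sum.swap)
  also have "\<dots> = (\<Sum>i<p. \<Sum>k<p. \<Sum>j<r. \<Sum>l<r. (A i j * A k j) * (B i l * B k l))"
    by (rule sum.cong[OF refl]) (rule sum.swap)
  also have "\<dots> = (\<Sum>i<p. \<Sum>k<p. projm r A i k * projm r B i k)"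
    by (simp add: projm_def sum_product)
  finally show ?thesis ..
qed

lemma orth_frameD:
  "orth_frame p r V \<Longrightarrow> j < r \<Longrightarrow> k < r \<Longrightarrow> (\<Sum>i<p. V i j * V i k) = (if j = k then 1 else 0)"
  by (simp add: orth_frame_def)

lemma sum_orth_frame_square:
  assumes "orth_frame p r V"
  shows "(\<Sum>j<r. \<Sum>l<r. (\<Sum>i<p. V i j * V i l)\<^sup>2) = r"
proof -
  have "(\<Sum>j<r. \<Sum>l<r. (\<Sum>i<p. V i j * V i l)\<^sup>2) = (\<Sum>j<r. \<Sum>l<r. if j = l then 1 else 0)"
    by (intro sum.cong refl) (simp add: orth_frameD[OF assms])
  then show ?thesis by simp
qed

text \<open>Expanding the square leaves two projections of squared norm r and a cross term given by
  \<open>sum_projm_mult\<close>.\<close>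

lemma proj_dist2_orth_frame:
  assumes "orth_frame p r A" "orth_frame p r B"
  shows "proj_dist2 p r A B = 2 * (r - (\<Sum>j<r. \<Sum>l<r. (\<Sum>i<p. A i j * B i l)\<^sup>2))"
proof -
  have "proj_dist2 p r A B = (\<Sum>i<p. \<Sum>k<p. projm r A i k * projm r A i k)
      + (\<Sum>i<p. \<Sum>k<p. projm r B i k * projm r B i k)
      - 2 * (\<Sum>i<p. \<Sum>k<p. projm r A i k * projm r B i k)"
    by (simp add: proj_dist2_projm power2_eq_square algebra_simps sum.distrib sum_subtractf
        sum_distrib_left)
  then show ?thesis
    by (simp only: sum_projm_mult sum_orth_frame_square[OF assms(1)] sum_orth_frame_square[OF assms(2)])
       simp
qed

text \<open>Pythagoras: VV'x is orthogonal to x - VV'x, and V'V = I gives |VV'x| = |V'x|.\<close>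

lemma orth_frame_residual:
  assumes "orth_frame p r V"
  shows "(\<Sum>i<p. (x i - (\<Sum>l<r. V i l * (\<Sum>k<p. V k l * x k)))\<^sup>2)
       = (\<Sum>i<p. (x i)\<^sup>2) - (\<Sum>l<r. (\<Sum>k<p. V k l * x k)\<^sup>2)"
proof -
  define c where "c l = (\<Sum>k<p. V k l * x k)" for l
  have "(\<Sum>i<p. x i * (\<Sum>l<r. V i l * c l)) = (\<Sum>i<p. \<Sum>l<r. V i l * x i * c l)"
    by (simp add: sum_distrib_left mult_ac)
  also have "\<dots> = (\<Sum>l<r. \<Sum>i<p. V i l * x i * c l)" by (rule sum.swap)
  also have "\<dots> = (\<Sum>l<r. (c l)\<^sup>2)"
    by (simp add: c_def sum_distrib_right power2_eq_square)
  finally have 1: "(\<Sum>i<p. x i * (\<Sum>l<r. V i l * c l)) = (\<Sum>l<r. (c l)\<^sup>2)" .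
  have "(\<Sum>i<p. (\<Sum>l<r. V i l * c l)\<^sup>2) = (\<Sum>i<p. \<Sum>l<r. \<Sum>m<r. V i l * V i m * (c l * c m))"
    by (simp add: power2_eq_square sum_product mult_ac)
  also have "\<dots> = (\<Sum>l<r. \<Sum>i<p. \<Sum>m<r. V i l * V i m * (c l * c m))"
    by (rule sum.swap)
  also have "\<dots> = (\<Sum>l<r. \<Sum>m<r. \<Sum>i<p. V i l * V i m * (c l * c m))"
    by (rule sum.cong[OF refl]) (rule sum.swap)
  also have "\<dots> = (\<Sum>l<r. \<Sum>m<r. (if l = m then 1 else 0) * (c l * c m))"
    by (intro sum.cong refl) (simp add: sum_distrib_right[symmetric] orth_frameD[OF assms])
  also have "\<dots> = (\<Sum>l<r. \<Sum>m<r. (if l = m then c l * c m else 0))"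
    by (intro sum.cong refl) simp
  also have "\<dots> = (\<Sum>l<r. (c l)\<^sup>2)" by (simp add: power2_eq_square)
  finally have 2: "(\<Sum>i<p. (\<Sum>l<r. V i l * c l)\<^sup>2) = (\<Sum>l<r. (c l)\<^sup>2)" .
  have "(\<Sum>i<p. (x i - (\<Sum>l<r. V i l * c l))\<^sup>2)
      = (\<Sum>i<p. (x i)\<^sup>2) - 2 * (\<Sum>i<p. x i * (\<Sum>l<r. V i l * c l)) + (\<Sum>i<p. (\<Sum>l<r. V i l * c l)\<^sup>2)"
    unfolding power2_diff by (simp add: sum.distrib sum_subtractf sum_distrib_left mult.assoc mult.left_commute[of _ 2])
  then show ?thesis unfolding 1 2 by (simp add: c_def)
qed

lemma orth_frame_bessel:
  assumes "orth_frame p r V"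
  shows "(\<Sum>l<r. (\<Sum>k<p. V k l * x k)\<^sup>2) \<le> (\<Sum>i<p. (x i)\<^sup>2)"
  using orth_frame_residual[OF assms, of x]
    sum_nonneg[of "{..<p}" "\<lambda>i. (x i - (\<Sum>l<r. V i l * (\<Sum>k<p. V k l * x k)))\<^sup>2"] by simp

lemma orth_frame_residual_le:
  assumes "orth_frame p r V"
  shows "(\<Sum>i<p. (x i - (\<Sum>l<r. V i l * (\<Sum>k<p. V k l * x k)))\<^sup>2) \<le> (\<Sum>i<p. (x i)\<^sup>2)"
  unfolding orth_frame_residual[OF assms] by (simp add: sum_nonneg)

text \<open>The identity in the top r rows of C replaces any rank argument: it alone shows that no
  residual vanishes. The coefficients T are carried through the induction so that the column spaces
  agree in both directions, VV'C = C and V = CT.\<close>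

lemma gram_schmidt:
  fixes C :: "nat \<Rightarrow> nat \<Rightarrow> real"
  assumes "r \<le> p" and C: "\<And>i j. i < r \<Longrightarrow> j < r \<Longrightarrow> C i j = (if i = j then 1 else 0)"
    and "k \<le> r"
  shows "\<exists>V T. orth_frame p k V \<and>
     (\<forall>i<p. \<forall>j<k. (\<Sum>l<k. V i l * (\<Sum>q<p. V q l * C q j)) = C i j) \<and>
     (\<forall>i<p. \<forall>l<k. V i l = (\<Sum>j<k. C i j * T j l))"
  using \<open>k \<le> r\<close>
proof (induction k)
  case 0
  then show ?case by (simp add: orth_frame_def)
next
  case (Suc k)
  then obtain V T where V: "orth_frame p k V"
    and span: "\<And>i j. i < p \<Longrightarrow> j < k \<Longrightarrow> (\<Sum>l<k. V i l * (\<Sum>q<p. V q l * C q j)) = C i j"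
    and T: "\<And>i l. i < p \<Longrightarrow> l < k \<Longrightarrow> V i l = (\<Sum>j<k. C i j * T j l)"
    by fastforce
  have kp: "k < p" "k < r" using Suc.prems assms by auto
  define c where "c l = (\<Sum>q<p. V q l * C q k)" for l
  define u where "u i = C i k - (\<Sum>l<k. V i l * c l)" for i
  define N where "N = sqrt (\<Sum>i<p. (u i)\<^sup>2)"
  \<comment> \<open>Each earlier basis vector combines columns j < k of C, which vanish in row k.
    The residual therefore keeps the entry 1 of column k in that row and can be normalised.\<close>
  have "V k l = 0" if "l < k" for l
    using T[OF kp(1) that] kp by (simp add: C)
  then have "u k = 1" using kp by (simp add: u_def C)
  then have pos: "(\<Sum>i<p. (u i)\<^sup>2) > 0"
    using kp by (intro sum_pos2[of _ k]) auto
  then have N: "N > 0" "N * N = (\<Sum>i<p. u i * u i)"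
    by (simp_all add: N_def power2_eq_square)
  have uV: "(\<Sum>i<p. V i l * u i) = 0" if l: "l < k" for l
  proof -
    have "(\<Sum>i<p. V i l * u i) = c l - (\<Sum>i<p. \<Sum>m<k. V i l * V i m * c m)"
      by (simp add: u_def c_def algebra_simps sum_subtractf sum_distrib_left)
    also have "(\<Sum>i<p. \<Sum>m<k. V i l * V i m * c m) = (\<Sum>m<k. \<Sum>i<p. V i l * V i m * c m)"
      by (rule sum.swap)
    also have "\<dots> = (\<Sum>m<k. (if l = m then 1 else 0) * c m)"
      by (intro sum.cong refl) (simp add: sum_distrib_right[symmetric] orth_frameD[OF V] l)
    also have "\<dots> = (\<Sum>m<k. if l = m then c m else 0)"
      by (intro sum.cong refl) simp
    also have "\<dots> = c l" using l by simp
    finally show ?thesis by simp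
  qed
  have comb: "(\<Sum>i<p. u i * (\<Sum>l<k. V i l * d l)) = 0" for d
  proof -
    have "(\<Sum>i<p. u i * (\<Sum>l<k. V i l * d l)) = (\<Sum>i<p. \<Sum>l<k. V i l * u i * d l)"
      by (simp add: sum_distrib_left mult_ac)
    also have "\<dots> = (\<Sum>l<k. \<Sum>i<p. V i l * u i * d l)" by (rule sum.swap)
    also have "\<dots> = 0" by (simp add: sum_distrib_right[symmetric] uV)
    finally show ?thesis .
  qed
  have uC: "(\<Sum>i<p. u i * C i j) = 0" if "j < k" for j
    using comb[of "\<lambda>l. \<Sum>q<p. V q l * C q j"] span[OF _ that] by simp
  have "(\<Sum>i<p. u i * C i k) = (\<Sum>i<p. u i * u i) + (\<Sum>i<p. u i * (\<Sum>l<k. V i l * c l))"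
    unfolding sum.distrib[symmetric] distrib_left[symmetric] by (simp add: u_def)
  then have uCk: "(\<Sum>i<p. u i * C i k) = N * N" by (simp add: comb N)
  define W where "W i l = (if l = k then u i / N else V i l)" for i l
  \<comment> \<open>From u = C e_k - Vc and V = CT, the new vector u / N has coefficient 1 / N on
    column k and -(Tc) / N on the earlier columns.\<close>
  define T' where "T' j l = (if l = k then (if j = k then 1 else - (\<Sum>m<k. T j m * c m)) / N
     else if j = k then 0 else T j l)" for j l
  have W_uk: "(\<Sum>i<p. W i k * f i) = (\<Sum>i<p. u i * f i) / N" for f
    by (simp add: W_def sum_divide_distrib)
  have "orth_frame p (Suc k) W"
    unfolding orth_frame_def
  proof (intro allI impI)
    fix a b assume "a < Suc k" "b < Suc k"
    then consider "a < k" "b < k" | "a < k" "b = k" | "a = k" "b < k" | "a = k" "b = k"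
      by linarith
    then show "(\<Sum>i<p. W i a * W i b) = (if a = b then 1 else 0)"
    proof cases
      case 1 then show ?thesis by (simp add: W_def orth_frameD[OF V])
    next
      case 2 then show ?thesis
        using uV[of a] by (simp add: W_def sum_divide_distrib[symmetric])
    next
      case 3 then show ?thesis
        using uV[of b] by (simp add: W_def sum_divide_distrib[symmetric] mult.commute)
    next
      case 4 then show ?thesis
        using N(1) by (simp add: W_def sum_divide_distrib[symmetric] N(2)[symmetric])
    qed
  qed
  moreover have "(\<Sum>l<Suc k. W i l * (\<Sum>q<p. W q l * C q j)) = C i j" if i: "i < p" and j: "j < Suc k" for i j
  proof -
    have *: "(\<Sum>l<Suc k. W i l * (\<Sum>q<p. W q l * C q j))
       = (\<Sum>l<k. V i l * (\<Sum>q<p. V q l * C q j)) + u i / N * ((\<Sum>q<p. u q * C q j) / N)"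
      by (simp add: W_def sum_divide_distrib)
    show ?thesis
    proof (cases "j = k")
      case True
      show ?thesis unfolding True *[unfolded True] uCk using N(1) by (simp add: u_def c_def)
    next
      case False
      then show ?thesis unfolding * using j span[OF i] uC by simp
    qed
  qed
  moreover have "W i l = (\<Sum>j<Suc k. C i j * T' j l)" if i: "i < p" and l: "l < Suc k" for i l
  proof (cases "l = k")
    case True
    have "(\<Sum>l<k. V i l * c l) = (\<Sum>l<k. \<Sum>j<k. C i j * (T j l * c l))"
      using i by (simp add: T sum_distrib_right mult.assoc)
    also have "\<dots> = (\<Sum>j<k. \<Sum>l<k. C i j * (T j l * c l))" by (rule sum.swap)
    finally have "u i = C i k - (\<Sum>j<k. C i j * (\<Sum>l<k. T j l * c l))"
      by (simp add: u_def sum_distrib_left)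
    then have "u i / N = (C i k - (\<Sum>j<k. C i j * (\<Sum>l<k. T j l * c l))) / N" by simp
    also have "\<dots> = (\<Sum>j<Suc k. C i j * T' j k)"
      by (simp add: T'_def diff_divide_distrib sum_negf sum_divide_distrib)
    finally show ?thesis using True by (simp add: W_def)
  next
    case False
    then show ?thesis using i l by (simp add: W_def T'_def T)
  qed
  ultimately show ?case by blast
qed

text \<open>The matrix \<open>[I; M]\<close>: the identity occupies the rows below \<open>r\<close>, and \<open>M\<close> keeps the row indices
from \<open>r\<close> on. Only those rows of \<open>M\<close> matter.\<close>

definition graph_mat :: "nat \<Rightarrow> (nat \<Rightarrow> nat \<Rightarrow> real) \<Rightarrow> nat \<Rightarrow> nat \<Rightarrow> real" where
  "graph_mat r M i j = (if i < r then (if i = j then 1 else 0) else M i j)"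

text \<open>The second clause is VV'[I; M] = [I; M]; the third is V = [I; M] T with T the first r
  rows of V itself. Together they say that the two column spaces agree.\<close>

definition graph_frame :: "nat \<Rightarrow> nat \<Rightarrow> (nat \<Rightarrow> nat \<Rightarrow> real) \<Rightarrow> (nat \<Rightarrow> nat \<Rightarrow> real) \<Rightarrow> bool" where
  "graph_frame p r M V \<longleftrightarrow> orth_frame p r V \<and>
     (\<forall>i<p. \<forall>j<r. (\<Sum>l<r. V i l * (\<Sum>q<p. V q l * graph_mat r M q j)) = graph_mat r M i j) \<and>
     (\<forall>i<p. \<forall>l<r. V i l = (\<Sum>j<r. graph_mat r M i j * V j l))"

text \<open>Gram-Schmidt gives V = [I; M] T for some T. Reading this in the first r rows, where
  [I; M] is the identity, shows that T is the top block of V.\<close>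

lemma graph_frame_exists:
  assumes "r \<le> p" shows "\<exists>V. graph_frame p r M V"
proof -
  obtain V T where V: "orth_frame p r V"
    "\<forall>i<p. \<forall>j<r. (\<Sum>l<r. V i l * (\<Sum>q<p. V q l * graph_mat r M q j)) = graph_mat r M i j"
    and T: "\<And>i l. i < p \<Longrightarrow> l < r \<Longrightarrow> V i l = (\<Sum>j<r. graph_mat r M i j * T j l)"
    using gram_schmidt[OF assms, of "graph_mat r M" r] by (auto simp: graph_mat_def)
  have "V j l = T j l" if "j < r" "l < r" for j l
  proof -
    have "V j l = (\<Sum>j'<r. if j = j' then T j' l else 0)"
      using T[of j l] that assms by (simp add: graph_mat_def if_distrib[of "\<lambda>x. x * _"] cong: if_cong)
    then show ?thesis using that by simp
  qed
  then have "\<forall>i<p. \<forall>l<r. V i l = (\<Sum>j<r. graph_mat r M i j * V j l)"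
    by (simp add: T)
  then show ?thesis using V unfolding graph_frame_def by blast
qed

lemma graph_frame_orth: "graph_frame p r M V \<Longrightarrow> orth_frame p r V"
  by (simp add: graph_frame_def)

text \<open>Row i of V is row i of [I; M] times the top block of V, so it vanishes together with row
  i of M. The identity rows use up r of the s rows allowed.\<close>

lemma graph_frame_nz_rows:
  assumes "graph_frame p r M V"
  shows "nz_rows p r V \<le> r + card {i. r \<le> i \<and> i < p \<and> (\<exists>j<r. M i j \<noteq> 0)}"
proof -
  let ?R = "{i. r \<le> i \<and> i < p \<and> (\<exists>j<r. M i j \<noteq> 0)}"
  have V: "V i l = (\<Sum>j<r. graph_mat r M i j * V j l)" if "i < p" "l < r" for i l
    using assms that unfolding graph_frame_def by blast
  have "{i. i < p \<and> (\<exists>j<r. V i j \<noteq> 0)} \<subseteq> {..<r} \<union> ?R"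
  proof
    fix i assume "i \<in> {i. i < p \<and> (\<exists>j<r. V i j \<noteq> 0)}"
    then obtain l where *: "i < p" "l < r" "V i l \<noteq> 0" by auto
    have "\<exists>j<r. M i j \<noteq> 0" if "r \<le> i"
    proof (rule ccontr)
      assume "\<not> ?thesis"
      then show False using V[OF *(1,2)] *(3) that by (simp add: graph_mat_def)
    qed
    then show "i \<in> {..<r} \<union> ?R" using * by auto
  qed
  then have "nz_rows p r V \<le> card ({..<r} \<union> ?R)"
    unfolding nz_rows_def by (intro card_mono) auto
  also have "\<dots> \<le> r + card ?R" using card_Un_le[of "{..<r}" ?R] by simp
  finally show ?thesis .
qed

section \<open>Perturbation of the projection when the graph matrix changes\<close>

definition frob2 :: "nat \<Rightarrow> nat \<Rightarrow> (nat \<Rightarrow> nat \<Rightarrow> real) \<Rightarrow> real" where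
  "frob2 p r M = (\<Sum>i\<in>{r..<p}. \<Sum>j<r. (M i j)\<^sup>2)"

lemma sum_lessThan_split:
  fixes f :: "nat \<Rightarrow> real" assumes "r \<le> p"
  shows "(\<Sum>i<p. f i) = (\<Sum>i<r. f i) + (\<Sum>i\<in>{r..<p}. f i)"
proof -
  have "{..<p} = {..<r} \<union> {r..<p}" using assms by auto
  then show ?thesis by (simp add: sum.union_disjoint ivl_disj_int)
qed

text \<open>The transposed top block of V is a contraction, being V' restricted to vectors supported
  on the first r coordinates.\<close>

lemma orth_frame_bessel_top:
  assumes "orth_frame p r V" "r \<le> p"
  shows "(\<Sum>l<r. (\<Sum>j<r. V j l * x j)\<^sup>2) \<le> (\<Sum>j<r. (x j)\<^sup>2)"
proof -
  have "(\<Sum>l<r. (\<Sum>k<p. V k l * (if k < r then x k else 0))\<^sup>2) \<le> (\<Sum>k<p. (if k < r then x k else 0)\<^sup>2)"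
    by (rule orth_frame_bessel[OF assms(1)])
  then show ?thesis by (simp add: sum_lessThan_split[OF assms(2)])
qed

text \<open>Let G and G' be the two graph matrices and T the top block of V', so that V' = GT + (G'
  - G)T. The projection onto the column space of V fixes GT, so only (G' - G)T enters the residual
  of V', and T does not increase its norm. The loss is twice that squared residual.\<close>

lemma graph_frame_dist_le:
  assumes "r \<le> p" and V: "graph_frame p r M V" and V': "graph_frame p r M' V'"
  shows "proj_dist2 p r V V' \<le> 2 * frob2 p r (\<lambda>i j. M' i j - M i j)"
proof -
  define D where "D i j = graph_mat r M' i j - graph_mat r M i j" for i j
  define w where "w l i = (\<Sum>j<r. D i j * V' j l)" for l i
  define z where "z l i = (\<Sum>j<r. graph_mat r M i j * V' j l)" for l i
  have oV: "orth_frame p r V" and oV': "orth_frame p r V'" using V V' by (auto simp: graph_frame_def)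
  have fixp: "(\<Sum>a<r. V i a * (\<Sum>k<p. V k a * graph_mat r M k j)) = graph_mat r M i j"
    if "i < p" "j < r" for i j using V that unfolding graph_frame_def by blast
  have split: "V' i l = w l i + z l i" if "i < p" "l < r" for i l
  proof -
    have "V' i l = (\<Sum>j<r. graph_mat r M' i j * V' j l)"
      using V' that unfolding graph_frame_def by blast
    then show ?thesis by (simp add: w_def z_def D_def algebra_simps sum_subtractf)
  qed
  have zfix: "(\<Sum>a<r. V i a * (\<Sum>k<p. V k a * z l k)) = z l i" if "i < p" for i l
  proof -
    have "(\<Sum>k<p. V k a * z l k) = (\<Sum>j<r. (\<Sum>k<p. V k a * graph_mat r M k j) * V' j l)" for a
    proof -
      have "(\<Sum>k<p. V k a * z l k) = (\<Sum>k<p. \<Sum>j<r. V k a * graph_mat r M k j * V' j l)"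
        by (simp add: z_def sum_distrib_left mult_ac)
      also have "\<dots> = (\<Sum>j<r. \<Sum>k<p. V k a * graph_mat r M k j * V' j l)" by (rule sum.swap)
      finally show ?thesis by (simp add: sum_distrib_right)
    qed
    then have "(\<Sum>a<r. V i a * (\<Sum>k<p. V k a * z l k))
       = (\<Sum>a<r. \<Sum>j<r. V i a * (\<Sum>k<p. V k a * graph_mat r M k j) * V' j l)"
      by (simp add: sum_distrib_left mult_ac)
    also have "\<dots> = (\<Sum>j<r. \<Sum>a<r. V i a * (\<Sum>k<p. V k a * graph_mat r M k j) * V' j l)"
      by (rule sum.swap)
    also have "\<dots> = (\<Sum>j<r. graph_mat r M i j * V' j l)"
      by (intro sum.cong refl) (simp add: sum_distrib_right[symmetric] fixp that)
    finally show ?thesis by (simp add: z_def)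
  qed
  have res: "(\<Sum>i<p. (V' i l - (\<Sum>a<r. V i a * (\<Sum>k<p. V k a * V' k l)))\<^sup>2) \<le> (\<Sum>i<p. (w l i)\<^sup>2)"
    if l: "l < r" for l
  proof -
    have "(\<Sum>k<p. V k a * V' k l) = (\<Sum>k<p. V k a * w l k) + (\<Sum>k<p. V k a * z l k)" for a
      using l by (simp add: split distrib_left sum.distrib)
    then have "(\<Sum>i<p. (V' i l - (\<Sum>a<r. V i a * (\<Sum>k<p. V k a * V' k l)))\<^sup>2)
       = (\<Sum>i<p. (w l i - (\<Sum>a<r. V i a * (\<Sum>k<p. V k a * w l k)))\<^sup>2)"
      using l by (intro sum.cong refl) (simp add: split distrib_left sum.distrib zfix)
    also have "\<dots> \<le> (\<Sum>i<p. (w l i)\<^sup>2)" by (rule orth_frame_residual_le[OF oV])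
    finally show ?thesis .
  qed
  have "(\<Sum>a<r. \<Sum>l<r. (\<Sum>i<p. V i a * V' i l)\<^sup>2) = (\<Sum>l<r. \<Sum>a<r. (\<Sum>i<p. V i a * V' i l)\<^sup>2)"
    by (rule sum.swap)
  moreover have "(\<Sum>l<r. (1::real)) = r" by simp
  moreover have "(\<Sum>i<p. (V' i l)\<^sup>2) = 1" if "l < r" for l
    using orth_frameD[OF oV' that that] by (simp add: power2_eq_square)
  \<comment> \<open>The columns of V' have total squared norm r, so this difference is the total
    squared residual of these columns after projection onto the column space of V.\<close>
  ultimately have "r - (\<Sum>a<r. \<Sum>l<r. (\<Sum>i<p. V i a * V' i l)\<^sup>2)
     = (\<Sum>l<r. (\<Sum>i<p. (V' i l)\<^sup>2) - (\<Sum>a<r. (\<Sum>i<p. V i a * V' i l)\<^sup>2))"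
    by (simp add: sum_subtractf)
  also have "\<dots> \<le> (\<Sum>l<r. \<Sum>i<p. (w l i)\<^sup>2)"
    by (intro sum_mono) (use res orth_frame_residual[OF oV] in auto)
  also have "\<dots> = (\<Sum>i<p. \<Sum>l<r. (\<Sum>j<r. V' j l * D i j)\<^sup>2)"
    unfolding w_def by (subst sum.swap) (simp add: mult.commute)
  also have "\<dots> \<le> (\<Sum>i<p. \<Sum>j<r. (D i j)\<^sup>2)"
    by (intro sum_mono orth_frame_bessel_top[OF oV' assms(1)])
  also have "\<dots> = frob2 p r (\<lambda>i j. M' i j - M i j)"
    by (simp add: sum_lessThan_split[OF assms(1)] D_def graph_mat_def frob2_def)
  finally show ?thesis using proj_dist2_orth_frame[OF oV oV'] by simp
qed

lemma projm_diag_graph_le: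
  assumes "r \<le> p" and V: "graph_frame p r M V" and i: "r \<le> i" "i < p"
  shows "projm r V i i \<le> frob2 p r M"
proof -
  have oV: "orth_frame p r V" using V by (auto simp: graph_frame_def)
  have "V i l = (\<Sum>j<r. V j l * M i j)" if "l < r" for l
    using V that i unfolding graph_frame_def by (auto simp: graph_mat_def mult.commute)
  then have "projm r V i i = (\<Sum>l<r. (\<Sum>j<r. V j l * M i j)\<^sup>2)"
    by (simp add: projm_def power2_eq_square)
  also have "\<dots> \<le> (\<Sum>j<r. (M i j)\<^sup>2)" by (rule orth_frame_bessel_top[OF oV assms(1)])
  also have "\<dots> \<le> frob2 p r M"
    unfolding frob2_def using i
    by (intro member_le_sum[of i _ "\<lambda>i. \<Sum>j<r. (M i j)\<^sup>2"]) (auto intro: sum_nonneg)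
  finally show ?thesis .
qed

text \<open>A projection P is symmetric with P^2 = P; this is the diagonal entry (i, i) of that
  equation.\<close>

lemma sum_projm_row_square:
  assumes "orth_frame p r V"
  shows "(\<Sum>k<p. (projm r V i k)\<^sup>2) = projm r V i i"
proof -
  have "(\<Sum>k<p. (projm r V i k)\<^sup>2) = (\<Sum>k<p. \<Sum>l<r. \<Sum>m<r. V k l * V k m * (V i l * V i m))"
    by (simp add: projm_def power2_eq_square sum_product mult_ac)
  also have "\<dots> = (\<Sum>l<r. \<Sum>k<p. \<Sum>m<r. V k l * V k m * (V i l * V i m))" by (rule sum.swap)
  also have "\<dots> = (\<Sum>l<r. \<Sum>m<r. \<Sum>k<p. V k l * V k m * (V i l * V i m))"
    by (rule sum.cong[OF refl]) (rule sum.swap)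
  also have "\<dots> = (\<Sum>l<r. \<Sum>m<r. if l = m then V i l * V i m else 0)"
    by (intro sum.cong refl) (simp add: sum_distrib_right[symmetric] orth_frameD[OF assms])
  finally show ?thesis by (simp add: projm_def)
qed

lemma abs_sum_mult_le:
  fixes f g :: "nat \<Rightarrow> real"
  assumes "(\<Sum>i\<in>A. (f i)\<^sup>2) \<le> a\<^sup>2" "(\<Sum>i\<in>A. (g i)\<^sup>2) \<le> b\<^sup>2" "0 \<le> a" "0 \<le> b"
  shows "\<bar>\<Sum>i\<in>A. f i * g i\<bar> \<le> a * b"
proof -
  have "(\<Sum>i\<in>A. f i * g i)\<^sup>2 \<le> (\<Sum>i\<in>A. (f i)\<^sup>2) * (\<Sum>i\<in>A. (g i)\<^sup>2)"
    by (rule Cauchy_Schwarz_ineq_sum)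
  also have "\<dots> \<le> a\<^sup>2 * b\<^sup>2" using assms by (intro mult_mono) (auto intro: sum_nonneg)
  finally have "(\<Sum>i\<in>A. f i * g i)\<^sup>2 \<le> (a * b)\<^sup>2" by (simp add: power_mult_distrib)
  then show ?thesis using assms by (metis abs_le_square_iff abs_of_nonneg mult_nonneg_nonneg)
qed

text \<open>Entry (i, j) of PG = G, with P the projection and G = [I; M], says that P_ij plus the
  sum of P_ik M_kj over k \<ge> r equals M_ij. Subtracting two such equations writes the deviation
  from linearity as two sums, each pairing a vector of norm O(d) with one of norm at most
  1/8.\<close>

lemma graph_frame_entry:
  assumes "r \<le> p" and V: "graph_frame p r M V" and V': "graph_frame p r M' V'"
    and M: "frob2 p r M \<le> 1 / 64" and M': "frob2 p r M' \<le> 1 / 64"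
    and i: "r \<le> i" "i < p" and j: "j < r"
    and d: "frob2 p r (\<lambda>i j. M' i j - M i j) \<le> d\<^sup>2" "0 \<le> d"
  shows "\<bar>(projm r V' i j - projm r V i j) - (M' i j - M i j)\<bar> \<le> d / 3"
proof -
  define \<delta> where "\<delta> k = projm r V' i k - projm r V i k" for k
  have fixP: "(\<Sum>k<p. projm r V i k * graph_mat r M k j) = graph_mat r M i j"
    if V: "graph_frame p r M V" for M V
  proof -
    have "(\<Sum>k<p. projm r V i k * graph_mat r M k j) = (\<Sum>k<p. \<Sum>l<r. V i l * (V k l * graph_mat r M k j))"
      by (simp add: projm_def sum_distrib_right mult.assoc)
    also have "\<dots> = (\<Sum>l<r. \<Sum>k<p. V i l * (V k l * graph_mat r M k j))" by (rule sum.swap)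
    also have "\<dots> = graph_mat r M i j"
    proof -
      have "(\<Sum>l<r. V i l * (\<Sum>k<p. V k l * graph_mat r M k j)) = graph_mat r M i j"
        using V i j unfolding graph_frame_def by blast
      then show ?thesis unfolding sum_distrib_left .
    qed
    finally show ?thesis .
  qed
  have top: "(\<Sum>k<p. f k * graph_mat r M k j) = f j + (\<Sum>k\<in>{r..<p}. f k * M k j)" for f M
  proof -
    have "(\<Sum>k<r. f k * (if k = j then 1 else 0)) = (\<Sum>k<r. if k = j then f k else 0)"
      by (intro sum.cong) auto
    then show ?thesis using j by (simp add: sum_lessThan_split[OF assms(1)] graph_mat_def)
  qed
  have "\<delta> j + (\<Sum>k\<in>{r..<p}. \<delta> k * M' k j)
     = (\<Sum>k<p. projm r V' i k * graph_mat r M' k j) - (\<Sum>k<p. projm r V i k * graph_mat r M' k j)"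
    unfolding top[of \<delta> M', symmetric] by (simp add: \<delta>_def left_diff_distrib sum_subtractf)
  also have "\<dots> = M' i j - (projm r V i j + (\<Sum>k\<in>{r..<p}. projm r V i k * M' k j))"
    using fixP[OF V'] i unfolding top[of "projm r V i" M'] by (simp add: graph_mat_def)
  also have "projm r V i j = M i j - (\<Sum>k\<in>{r..<p}. projm r V i k * M k j)"
    using fixP[OF V] i unfolding top[of "projm r V i" M] by (simp add: graph_mat_def)
  finally have eq: "\<delta> j - (M' i j - M i j)
     = - (\<Sum>k\<in>{r..<p}. \<delta> k * M' k j) - (\<Sum>k\<in>{r..<p}. projm r V i k * (M' k j - M k j))"
    by (simp add: right_diff_distrib sum_subtractf)
  have col: "(\<Sum>k\<in>{r..<p}. (N k j)\<^sup>2) \<le> frob2 p r N" for N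
    unfolding frob2_def using j by (intro sum_mono member_le_sum) auto
  have "(\<Sum>k<p. (\<delta> k)\<^sup>2) \<le> proj_dist2 p r V' V"
    unfolding proj_dist2_projm \<delta>_def
    using i by (intro member_le_sum[of i _ "\<lambda>i. \<Sum>k<p. (projm r V' i k - projm r V i k)\<^sup>2"]) (auto intro: sum_nonneg)
  also have "\<dots> \<le> 2 * frob2 p r (\<lambda>i j. M i j - M' i j)"
    by (rule graph_frame_dist_le[OF assms(1) V' V])
  also have "\<dots> = 2 * frob2 p r (\<lambda>i j. M' i j - M i j)"
    by (simp add: frob2_def power2_commute)
  \<comment> \<open>The factor 2 is raised to 9/4 to have the rational square root 3/2.\<close>
  also have "\<dots> \<le> (9 / 4) * d\<^sup>2" 
  proof -
    have "0 \<le> d\<^sup>2" by simp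
    then show ?thesis using d(1) by linarith
  qed
  also have "\<dots> = (3 / 2 * d)\<^sup>2" by (simp add: power_mult_distrib power_divide)
  finally have "(\<Sum>k<p. (\<delta> k)\<^sup>2) \<le> (3 / 2 * d)\<^sup>2" .
  then have "(\<Sum>k\<in>{r..<p}. (\<delta> k)\<^sup>2) \<le> (3 / 2 * d)\<^sup>2"
    using sum_lessThan_split[OF assms(1), of "\<lambda>k. (\<delta> k)\<^sup>2"] sum_nonneg[of "{..<r}" "\<lambda>k. (\<delta> k)\<^sup>2"] by simp
  then have 1: "\<bar>\<Sum>k\<in>{r..<p}. \<delta> k * M' k j\<bar> \<le> 3 / 2 * d * (1 / 8)"
    using col[of M'] M' d by (intro abs_sum_mult_le) (auto simp: power_divide)
  have "(\<Sum>k<p. (projm r V i k)\<^sup>2) \<le> 1 / 64"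
    using projm_diag_graph_le[OF assms(1) V i] M sum_projm_row_square[OF graph_frame_orth[OF V]] by simp
  then have "(\<Sum>k\<in>{r..<p}. (projm r V i k)\<^sup>2) \<le> (1 / 8)\<^sup>2"
    using sum_lessThan_split[OF assms(1), of "\<lambda>k. (projm r V i k)\<^sup>2"]
      sum_nonneg[of "{..<r}" "\<lambda>k. (projm r V i k)\<^sup>2"] by (simp add: power_divide)
  then have 2: "\<bar>\<Sum>k\<in>{r..<p}. projm r V i k * (M' k j - M k j)\<bar> \<le> 1 / 8 * d"
    using col[of "\<lambda>i j. M' i j - M i j"] d by (intro abs_sum_mult_le) auto
  have "\<bar>\<delta> j - (M' i j - M i j)\<bar> \<le> 3 / 2 * d * (1 / 8) + 1 / 8 * d"
    unfolding eq using 1 2 by linarith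
  \<comment> \<open>The sum is 3/16 + 1/8 = 5/16 times d.\<close>
  also have "\<dots> \<le> d / 3" using d by simp
  finally show ?thesis by (simp add: \<delta>_def)
qed

lemma abs_projm_le_1:
  assumes "orth_frame p r V" "i < p" "k < p"
  shows "\<bar>projm r V i k\<bar> \<le> 1"
proof -
  have *: "(projm r V i k)\<^sup>2 \<le> projm r V i i" if "k < p" for k
    using that unfolding sum_projm_row_square[OF assms(1), symmetric] by (intro member_le_sum) auto
  have "(projm r V i i)\<^sup>2 \<le> projm r V i i" using *[OF assms(2)] .
  then have "projm r V i i \<le> 1"
    by (cases "projm r V i i \<le> 0") (auto simp: power2_eq_square)
  then have "(projm r V i k)\<^sup>2 \<le> 1" using *[OF assms(3)] by simp
  then show ?thesis by (simp add: abs_square_le_1)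
qed

text \<open>A crude bound is enough: it serves integrability of the loss and boundedness of the
  risk, without which a real supremum would carry no information.\<close>

lemma proj_dist2_le:
  assumes "orth_frame p r A" "orth_frame p r B"
  shows "proj_dist2 p r A B \<le> 4 * (real p)\<^sup>2"
proof -
  have "(projm r A i k - projm r B i k)\<^sup>2 \<le> 4" if "i < p" "k < p" for i k
  proof -
    have "\<bar>projm r A i k - projm r B i k\<bar> \<le> 2"
      using abs_projm_le_1[OF assms(1) that] abs_projm_le_1[OF assms(2) that] by linarith
    then have "\<bar>projm r A i k - projm r B i k\<bar>\<^sup>2 \<le> 2\<^sup>2" by (intro power_mono) auto
    then show ?thesis by simp
  qed
  then have "proj_dist2 p r A B \<le> (\<Sum>i<p. \<Sum>k<p. 4)"
    unfolding proj_dist2_projm by (intro sum_mono) auto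
  then show ?thesis by (simp add: power2_eq_square)
qed

lemma proj_dist2_nonneg: "0 \<le> proj_dist2 p r A B"
  by (simp add: proj_dist2_def sum_nonneg)

subsection \<open>Gaussian product measures\<close>

lemma sets_std_gauss [measurable_cong, simp]: "sets std_gauss = sets borel"
  by (simp add: std_gauss_def)

lemma space_std_gauss [simp]: "space std_gauss = UNIV"
  by (simp add: std_gauss_def)

lemma prob_space_std_gauss: "prob_space std_gauss"
  unfolding std_gauss_def by (rule prob_space_normal_density) simp

interpretation std_gauss: prob_space std_gauss
  by (rule prob_space_std_gauss)

interpretation std_gauss_prod: product_prob_space "\<lambda>_. std_gauss" I for I
  by unfold_locales

lemma nn_integral_std_gauss:
  "f \<in> borel_measurable borel \<Longrightarrow>
    (\<integral>\<^sup>+x. f x \<partial>std_gauss) = (\<integral>\<^sup>+x. ennreal (std_normal_density x) * f x \<partial>lborel)"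
  unfolding std_gauss_def by (subst nn_integral_density) auto

text \<open>Completing the square: against the standard normal density the integrand is a multiple
  of the normal density with mean b / (1 + c) and variance 1 / (1 + c).\<close>

lemma std_gauss_exp_quadratic:
  assumes "0 \<le> c"
  shows "(\<integral>\<^sup>+u. ennreal (exp (b * u - c * u\<^sup>2 / 2)) \<partial>std_gauss)
       = ennreal (1 / sqrt (1 + c) * exp (b\<^sup>2 / (2 * (1 + c))))"
proof -
  let ?K = "1 / sqrt (1 + c) * exp (b\<^sup>2 / (2 * (1 + c)))"
  have c: "1 + c > 0" using assms by simp
  have *: "std_normal_density u * exp (b * u - c * u\<^sup>2 / 2)
     = ?K * normal_density (b / (1 + c)) (1 / sqrt (1 + c)) u" for u
  proof -
    have e: "- u\<^sup>2 / 2 + (b * u - c * u\<^sup>2 / 2)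
       = b\<^sup>2 / (2 * (1 + c)) + - (u - b / (1 + c))\<^sup>2 / (2 * (1 / sqrt (1 + c))\<^sup>2)"
    proof -
      define d where "d = 1 + c"
      have "(u - b / d)\<^sup>2 * d = u\<^sup>2 * d - 2 * u * b + b\<^sup>2 / d"
        using c by (simp add: d_def[symmetric] power2_eq_square field_simps)
      moreover have "- (u - b / d)\<^sup>2 / (2 * (1 / sqrt d)\<^sup>2) = - ((u - b / d)\<^sup>2 * d) / 2"
        using c by (simp add: d_def power_divide)
      moreover have "b\<^sup>2 / (2 * d) = b\<^sup>2 / d / 2" "c * u\<^sup>2 = u\<^sup>2 * d - u\<^sup>2"
        by (simp_all add: d_def algebra_simps)
      ultimately show ?thesis unfolding d_def[symmetric]
        by (simp only: diff_divide_distrib add_divide_distrib minus_divide_left) (simp add: mult.commute diff_divide_distrib add_divide_distrib)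
    qed
    have "std_normal_density u * exp (b * u - c * u\<^sup>2 / 2)
       = 1 / sqrt (2 * pi) * exp (- u\<^sup>2 / 2 + (b * u - c * u\<^sup>2 / 2))"
      unfolding std_normal_density_def exp_add by simp
    also have "\<dots> = ?K * normal_density (b / (1 + c)) (1 / sqrt (1 + c)) u"
      unfolding e exp_add normal_density_def using c
      by (simp add: power_divide real_sqrt_divide real_sqrt_mult)
    finally show ?thesis .
  qed
  have "(\<integral>\<^sup>+u. ennreal (exp (b * u - c * u\<^sup>2 / 2)) \<partial>std_gauss)
     = (\<integral>\<^sup>+u. ennreal (std_normal_density u * exp (b * u - c * u\<^sup>2 / 2)) \<partial>lborel)"
    by (simp add: nn_integral_std_gauss ennreal_mult)
  also have "\<dots> = (\<integral>\<^sup>+u. ennreal ?K * ennreal (normal_density (b / (1 + c)) (1 / sqrt (1 + c)) u) \<partial>lborel)"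
    unfolding * by (intro nn_integral_cong ennreal_mult) (use c in auto)
  also have "\<dots> = ennreal ?K * (\<integral>\<^sup>+u. ennreal (normal_density (b / (1 + c)) (1 / sqrt (1 + c)) u) \<partial>lborel)"
    by (rule nn_integral_cmult) simp
  also have "(\<integral>\<^sup>+u. ennreal (normal_density (b / (1 + c)) (1 / sqrt (1 + c)) u) \<partial>lborel) = 1"
    using c by (subst nn_integral_eq_integral) auto
  finally show ?thesis by simp
qed

text \<open>The one-dimensional Cameron-Martin formula, by translation invariance of Lebesgue
  measure.\<close>

lemma std_gauss_shift:
  "distr std_gauss borel (\<lambda>z. a + z) = density std_gauss (\<lambda>x. ennreal (exp (a * x - a\<^sup>2 / 2)))"
proof (rule measure_eqI)
  fix A assume "A \<in> sets (distr std_gauss borel (\<lambda>z. a + z))"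
  then have A [measurable]: "A \<in> sets borel" by simp
  have *: "std_normal_density (a + z) * exp (a * (a + z) - a\<^sup>2 / 2) = std_normal_density z" for z
  proof -
    have e: "- (a + z)\<^sup>2 / 2 + (a * (a + z) - a\<^sup>2 / 2) = - z\<^sup>2 / 2"
      by (simp add: power2_eq_square field_simps)
    have "std_normal_density (a + z) * exp (a * (a + z) - a\<^sup>2 / 2)
       = 1 / sqrt (2 * pi) * exp (- (a + z)\<^sup>2 / 2 + (a * (a + z) - a\<^sup>2 / 2))"
      unfolding std_normal_density_def exp_add by simp
    then show ?thesis unfolding e by (simp add: std_normal_density_def)
  qed
  have "emeasure (density std_gauss (\<lambda>x. ennreal (exp (a * x - a\<^sup>2 / 2)))) A
     = (\<integral>\<^sup>+x. ennreal (std_normal_density x) * (ennreal (exp (a * x - a\<^sup>2 / 2)) * indicator A x) \<partial>lborel)"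
    by (subst emeasure_density) (auto simp: nn_integral_std_gauss)
  also have "\<dots> = (\<integral>\<^sup>+z. ennreal (std_normal_density (a + z)) *
      (ennreal (exp (a * (a + z) - a\<^sup>2 / 2)) * indicator A (a + z)) \<partial>lborel)"
    by (subst nn_integral_real_affine[where c = 1 and t = a]) auto
  also have "\<dots> = (\<integral>\<^sup>+z. ennreal (std_normal_density z) * indicator A (a + z) \<partial>lborel)"
    by (simp add: mult.assoc[symmetric] ennreal_mult[symmetric] *)
  also have "\<dots> = (\<integral>\<^sup>+z. indicator A (a + z) \<partial>std_gauss)"
    by (simp add: nn_integral_std_gauss)
  also have "\<dots> = (\<integral>\<^sup>+z. indicator A z \<partial>distr std_gauss borel (\<lambda>z. a + z))"
    by (subst nn_integral_distr) auto
  also have "\<dots> = emeasure (distr std_gauss borel (\<lambda>z. a + z)) A"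
    by simp
  finally show "emeasure (distr std_gauss borel (\<lambda>z. a + z)) A
     = emeasure (density std_gauss (\<lambda>x. ennreal (exp (a * x - a\<^sup>2 / 2)))) A" ..
qed simp

text \<open>Both measures agree on boxes with the product of the shifted one-dimensional laws, since
  the density on the right factors over the coordinates.\<close>

lemma PiM_std_gauss_shift:
  assumes I: "finite I"
  shows "distr (PiM I (\<lambda>_. std_gauss)) (PiM I (\<lambda>_. std_gauss)) (\<lambda>z. \<lambda>i\<in>I. a i + z i)
    = density (PiM I (\<lambda>_. std_gauss)) (\<lambda>x. \<Prod>i\<in>I. ennreal (exp (a i * x i - (a i)\<^sup>2 / 2)))"
    (is "?D = ?E")
proof -
  define N where "N i = distr std_gauss borel (\<lambda>z. a i + z)" for i
  interpret N: product_prob_space N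
    by (intro product_prob_spaceI) (auto simp: N_def intro!: std_gauss.prob_space_distr)
  have sets: "sets (PiM I (\<lambda>_. std_gauss)) = sets (PiM I N)"
    by (rule sets_PiM_cong) (auto simp: N_def)
  have shift [measurable]: "(\<lambda>z. \<lambda>i\<in>I. a i + z i) \<in> measurable (PiM I (\<lambda>_. std_gauss)) (PiM I (\<lambda>_. std_gauss))"
    by (intro measurable_restrict) measurable
  have "?D = PiM I N"
  proof (rule N.PiM_eqI[OF I])
    fix A assume A: "\<And>i. i \<in> I \<Longrightarrow> A i \<in> sets (N i)"
    then have A': "A i \<in> sets borel" if "i \<in> I" for i using that by (simp add: N_def)
    have "emeasure ?D (Pi\<^sub>E I A) = emeasure (PiM I (\<lambda>_. std_gauss))
        ((\<lambda>z. \<lambda>i\<in>I. a i + z i) -` Pi\<^sub>E I A \<inter> space (PiM I (\<lambda>_. std_gauss)))"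
      using A' I by (intro emeasure_distr shift) (auto intro!: sets_PiM_I_finite)
    also have "(\<lambda>z. \<lambda>i\<in>I. a i + z i) -` Pi\<^sub>E I A \<inter> space (PiM I (\<lambda>_. std_gauss))
        = Pi\<^sub>E I (\<lambda>i. (\<lambda>z. a i + z) -` A i)"
      by (auto simp: space_PiM PiE_def Pi_def)
    also have "emeasure (PiM I (\<lambda>_. std_gauss)) (Pi\<^sub>E I (\<lambda>i. (\<lambda>z. a i + z) -` A i)) = (\<Prod>i\<in>I. emeasure std_gauss ((\<lambda>z. a i + z) -` A i))"
    proof (rule std_gauss_prod.emeasure_PiM[OF I])
      fix i assume "i \<in> I"
      then show "(\<lambda>z. a i + z) -` A i \<in> sets std_gauss"
        using measurable_sets_borel[of "\<lambda>z. a i + z" borel "A i"] A' by simp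
    qed
    also have "\<dots> = (\<Prod>i\<in>I. emeasure (N i) (A i))"
      using A' by (intro prod.cong refl) (auto simp: N_def emeasure_distr)
    finally show "emeasure ?D (Pi\<^sub>E I A) = (\<Prod>i\<in>I. emeasure (N i) (A i))" .
  qed (simp add: sets)
  moreover have "?E = PiM I N"
  proof (rule N.PiM_eqI[OF I])
    fix A assume A: "\<And>i. i \<in> I \<Longrightarrow> A i \<in> sets (N i)"
    then have A' [measurable]: "A i \<in> sets borel" if "i \<in> I" for i using that by (simp add: N_def)
    have "emeasure ?E (Pi\<^sub>E I A) = (\<integral>\<^sup>+x. (\<Prod>i\<in>I. ennreal (exp (a i * x i - (a i)\<^sup>2 / 2))) *
        indicator (Pi\<^sub>E I A) x \<partial>PiM I (\<lambda>_. std_gauss))"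
      using A' I by (intro emeasure_density) (auto intro!: sets_PiM_I_finite)
    also have "\<dots> = (\<integral>\<^sup>+x. (\<Prod>i\<in>I. ennreal (exp (a i * x i - (a i)\<^sup>2 / 2)) * indicator (A i) (x i))
        \<partial>PiM I (\<lambda>_. std_gauss))"
    proof (rule nn_integral_cong)
      fix x assume x: "x \<in> space (PiM I (\<lambda>_. std_gauss))"
      have "indicator (Pi\<^sub>E I A) x = (\<Prod>i\<in>I. indicator (A i) (x i) :: ennreal)"
      proof (cases "\<forall>i\<in>I. x i \<in> A i")
        case True
        then have "x \<in> Pi\<^sub>E I A" using x by (auto simp: space_PiM PiE_def)
        then show ?thesis using True by simp
      next
        case False
        then have "x \<notin> Pi\<^sub>E I A" by auto
        moreover have "(\<Prod>i\<in>I. indicator (A i) (x i) :: ennreal) = 0"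
          using False I by (intro prod_zero) (auto simp: indicator_def)
        ultimately show ?thesis by simp
      qed
      then show "(\<Prod>i\<in>I. ennreal (exp (a i * x i - (a i)\<^sup>2 / 2))) * indicator (Pi\<^sub>E I A) x
        = (\<Prod>i\<in>I. ennreal (exp (a i * x i - (a i)\<^sup>2 / 2)) * indicator (A i) (x i))"
        by (simp add: prod.distrib)
    qed
    also have "\<dots> = (\<Prod>i\<in>I. \<integral>\<^sup>+x. ennreal (exp (a i * x - (a i)\<^sup>2 / 2)) * indicator (A i) x \<partial>std_gauss)"
      using I by (intro std_gauss_prod.product_nn_integral_prod) auto
    also have "\<dots> = (\<Prod>i\<in>I. emeasure (N i) (A i))"
      by (intro prod.cong refl) (simp add: N_def std_gauss_shift emeasure_density)
    finally show "emeasure ?E (Pi\<^sub>E I A) = (\<Prod>i\<in>I. emeasure (N i) (A i))" .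
  qed (simp add: sets)
  ultimately show ?thesis by simp
qed

section \<open>First and second moments of Gaussian coordinates\<close>

lemma std_gauss_moments:
  shows "has_bochner_integral std_gauss (\<lambda>x. x) 0"
    and "has_bochner_integral std_gauss (\<lambda>x. x\<^sup>2) 1"
proof -
  have "has_bochner_integral lborel (\<lambda>x. std_normal_density x *\<^sub>R x) 0"
    using std_normal_moment_odd[of 0] by simp
  then show "has_bochner_integral std_gauss (\<lambda>x. x) 0"
    unfolding std_gauss_def by (rule has_bochner_integral_density[rotated 3]) auto
  have "has_bochner_integral lborel (\<lambda>x. std_normal_density x *\<^sub>R x\<^sup>2) 1"
    using std_normal_moment_even[of 1] by (simp add: fact_2)
  then show "has_bochner_integral std_gauss (\<lambda>x. x\<^sup>2) 1"
    unfolding std_gauss_def by (rule has_bochner_integral_density[rotated 3]) auto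
qed

text \<open>A coordinate is a product of one-variable functions, all but one constantly 1, so
  integration of products yields integrability and value at once. The bilinear case uses the same
  device.\<close>

lemma PiM_std_gauss_linear:
  assumes "finite I" "e \<in> I"
  shows "has_bochner_integral (PiM I (\<lambda>_. std_gauss)) (\<lambda>x. x e) 0"
proof -
  define f :: "'a \<Rightarrow> real \<Rightarrow> real" where "f i = (if i = e then (\<lambda>x. x) else (\<lambda>_. 1))" for i
  have f: "\<And>i. i \<in> I \<Longrightarrow> integrable std_gauss (f i)"
    using std_gauss_moments(1) by (auto simp: f_def intro: integrable.intros)
  have 1: "(\<Prod>i\<in>I. f i (x i)) = x e" for x
    using assms by (simp add: f_def if_distrib[of "\<lambda>f. f _"] prod.delta cong: if_cong)
  have 2: "(\<Prod>i\<in>I. integral\<^sup>L std_gauss (f i)) = 0"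
    using assms std_gauss_moments(1)
    by (intro prod_zero) (auto intro!: bexI[of _ e] simp: f_def has_bochner_integral_integral_eq)
  show ?thesis
    using std_gauss_prod.product_integrable_prod[where f = f, OF assms(1) f]
      std_gauss_prod.product_integral_prod[where f = f, OF assms(1) f]
    by (simp add: has_bochner_integral_iff 1 2)
qed

lemma PiM_std_gauss_bilinear:
  assumes "finite I" "e \<in> I" "e' \<in> I"
  shows "has_bochner_integral (PiM I (\<lambda>_. std_gauss)) (\<lambda>x. x e * x e') (if e = e' then 1 else 0)"
proof -
  define f :: "'a \<Rightarrow> real \<Rightarrow> real" where
    "f i = (if i = e then if e = e' then (\<lambda>x. x\<^sup>2) else (\<lambda>x. x) else if i = e' then (\<lambda>x. x) else (\<lambda>_. 1))" for i
  have f: "\<And>i. i \<in> I \<Longrightarrow> integrable std_gauss (f i)"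
    using std_gauss_moments by (auto simp: f_def intro: integrable.intros)
  have 1: "(\<Prod>i\<in>I. f i (x i)) = x e * x e'" for x
  proof (cases "e = e'")
    case True
    then have "(\<Prod>i\<in>I. f i (x i)) = (\<Prod>i\<in>I. if i = e then (x i)\<^sup>2 else 1)"
      by (intro prod.cong) (auto simp: f_def)
    then show ?thesis using assms True by (simp add: power2_eq_square)
  next
    case False
    then have "(\<Prod>i\<in>I. f i (x i)) = (\<Prod>i\<in>I. (if i = e then x i else 1) * (if i = e' then x i else 1))"
      by (intro prod.cong) (auto simp: f_def)
    then show ?thesis using assms by (simp add: prod.distrib)
  qed
  have 2: "(\<Prod>i\<in>I. integral\<^sup>L std_gauss (f i)) = (if e = e' then 1 else 0)"
  proof (cases "e = e'")
    case True
    then have "integral\<^sup>L std_gauss (f i) = 1" for i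
      using std_gauss_moments(2) std_gauss.prob_space by (auto simp: f_def has_bochner_integral_integral_eq)
    then show ?thesis using True by simp
  next
    case False
    then have "integral\<^sup>L std_gauss (f e) = 0"
      using std_gauss_moments(1) by (auto simp: f_def has_bochner_integral_integral_eq)
    then show ?thesis using False assms by (auto intro: prod_zero)
  qed
  show ?thesis
    using std_gauss_prod.product_integrable_prod[where f = f, OF assms(1) f]
      std_gauss_prod.product_integral_prod[where f = f, OF assms(1) f]
    by (simp add: has_bochner_integral_iff 1 2)
qed

text \<open>Linear and mixed terms have mean zero. The constant a makes room for the contribution of
  U while Z is being integrated.\<close>

lemma PiM_std_gauss_affine_square:
  assumes I: "finite I" and S: "S \<subseteq> I"
  shows "has_bochner_integral (PiM I (\<lambda>_. std_gauss)) (\<lambda>x. (a + (\<Sum>e\<in>S. c e * x e))\<^sup>2)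
    (a\<^sup>2 + (\<Sum>e\<in>S. (c e)\<^sup>2))"
proof -
  have fS: "finite S" using assms finite_subset by auto
  have P1: "measure (PiM I (\<lambda>_. std_gauss)) (space (PiM I (\<lambda>_. std_gauss))) = 1"
    by (intro prob_space.prob_space prob_space_PiM prob_space_std_gauss)
  have "has_bochner_integral (PiM I (\<lambda>_. std_gauss))
    (\<lambda>x. a\<^sup>2 + (\<Sum>e\<in>S. 2 * a * c e * x e) + (\<Sum>e\<in>S. \<Sum>e'\<in>S. (c e * c e') * (x e * x e')))
    (a\<^sup>2 + (\<Sum>e\<in>S. 2 * a * c e * 0) + (\<Sum>e\<in>S. \<Sum>e'\<in>S. (c e * c e') * (if e = e' then 1 else 0)))"
    using S
    by (intro has_bochner_integral_add has_bochner_integral_sum has_bochner_integral_mult_right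
        PiM_std_gauss_linear PiM_std_gauss_bilinear I)
      (auto simp: has_bochner_integral_iff P1)
  moreover have "a\<^sup>2 + (\<Sum>e\<in>S. 2 * a * c e * x e) + (\<Sum>e\<in>S. \<Sum>e'\<in>S. (c e * c e') * (x e * x e'))
      = (a + (\<Sum>e\<in>S. c e * x e))\<^sup>2" for x
    by (simp add: power2_sum sum_distrib_left power2_eq_square[of "sum _ _"] sum_product mult_ac)
  moreover have "(\<Sum>e\<in>S. \<Sum>e'\<in>S. (c e * c e') * (if e = e' then 1 else 0)) = (\<Sum>e\<in>S. (c e)\<^sup>2)"
    using fS by (simp add: if_distrib power2_eq_square cong: if_cong)
  ultimately show ?thesis by simp
qed

subsection \<open>The law of the spiked model\<close>

abbreviation gauss_mat :: "nat \<Rightarrow> nat \<Rightarrow> (nat \<times> nat \<Rightarrow> real) measure" where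
  "gauss_mat n p \<equiv> PiM ({..<n} \<times> {..<p}) (\<lambda>_. std_gauss)"

lemma prob_space_gauss_mat: "prob_space (gauss_mat n p)"
  by (intro prob_space_PiM prob_space_std_gauss)

lemma sets_gauss_mat: "sets (gauss_mat n p) = sets (data_space n p)"
  unfolding data_space_def by (intro sets_PiM_cong) auto

lemma prob_space_noise: "prob_space (noise_space n p r)"
  unfolding noise_space_def by (intro prob_space_pair prob_space_gauss_mat)

lemma pair_sigma_finite_gauss_mat: "pair_sigma_finite (gauss_mat n r) (gauss_mat n p)"
  by (intro pair_sigma_finite.intro prob_space_imp_sigma_finite prob_space_gauss_mat)

text \<open>The conditional mean of X given U = u when all spikes equal \<open>lmb\<close>; given u,
  the law of X is a translate of the law of Z.\<close>

definition spiked_mean :: "nat \<Rightarrow> real \<Rightarrow> (nat \<Rightarrow> nat \<Rightarrow> real) \<Rightarrow> (nat \<times> nat \<Rightarrow> real) \<Rightarrow> nat \<times> nat \<Rightarrow> real" where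
  "spiked_mean r lmb V u = (\<lambda>(i, k). \<Sum>j<r. u (i, j) * sqrt lmb * V k j)"

lemma spiked_X_eq:
  "spiked_X n p r V (\<lambda>_. lmb) (u, z) = (\<lambda>e\<in>{..<n} \<times> {..<p}. spiked_mean r lmb V u e + z e)"
  by (auto simp: spiked_X_def spiked_mean_def fun_eq_iff)

lemma measurable_gauss_mat_component:
  "e \<in> {..<n} \<times> {..<p} \<Longrightarrow> (\<lambda>z. z e) \<in> borel_measurable (gauss_mat n p)"
  using measurable_component_singleton[of e "{..<n} \<times> {..<p}" "\<lambda>_. std_gauss"]
  by (simp add: measurable_cong_sets[OF refl sets_std_gauss])

lemma measurable_spiked_mean:
  assumes "e \<in> {..<n} \<times> {..<p}"
  shows "(\<lambda>u. spiked_mean r lmb V u e) \<in> borel_measurable (gauss_mat n r)"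
  using assms unfolding spiked_mean_def
  by (cases e) (auto intro!: borel_measurable_sum borel_measurable_times measurable_gauss_mat_component)

lemma measurable_spiked_X:
  "spiked_X n p r V (\<lambda>_. lmb) \<in> measurable (noise_space n p r) (data_space n p)"
proof -
  have "(\<lambda>\<omega>. \<lambda>e\<in>{..<n} \<times> {..<p}. spiked_mean r lmb V (fst \<omega>) e + snd \<omega> e)
     \<in> measurable (noise_space n p r) (data_space n p)"
    unfolding noise_space_def data_space_def
  proof (rule measurable_restrict)
    fix e assume e: "e \<in> {..<n} \<times> {..<p}"
    note [measurable] = measurable_spiked_mean[OF e]
    have [measurable]: "(\<lambda>z. z e) \<in> borel_measurable (gauss_mat n p)"
      using measurable_gauss_mat_component[OF e] .
    show "(\<lambda>\<omega>. spiked_mean r lmb V (fst \<omega>) e + snd \<omega> e)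
       \<in> borel_measurable (gauss_mat n r \<Otimes>\<^sub>M gauss_mat n p)"
      by measurable
  qed
  also have "(\<lambda>\<omega>. \<lambda>e\<in>{..<n} \<times> {..<p}. spiked_mean r lmb V (fst \<omega>) e + snd \<omega> e)
     = spiked_X n p r V (\<lambda>_. lmb)"
    by (rule ext) (simp add: spiked_X_eq[symmetric])
  finally show ?thesis .
qed

definition spiked_stat :: "nat \<Rightarrow> nat \<Rightarrow> nat \<Rightarrow> (nat \<Rightarrow> nat \<Rightarrow> real) \<Rightarrow> (nat \<times> nat \<Rightarrow> real) \<Rightarrow> real" where
  "spiked_stat n p r V x = (\<Sum>i<n. \<Sum>j<r. (\<Sum>k<p. x (i, k) * V k j)\<^sup>2)"

definition spiked_lik :: "nat \<Rightarrow> nat \<Rightarrow> nat \<Rightarrow> real \<Rightarrow> (nat \<Rightarrow> nat \<Rightarrow> real) \<Rightarrow> (nat \<times> nat \<Rightarrow> real) \<Rightarrow> real" where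
  "spiked_lik n p r lmb V x =
     (1 / sqrt (1 + lmb)) ^ (n * r) * exp (lmb / (2 * (1 + lmb)) * spiked_stat n p r V x)"

lemma measurable_spiked_stat [measurable]: "spiked_stat n p r V \<in> borel_measurable (gauss_mat n p)"
proof -
  have [measurable]: "(\<lambda>z. z e) \<in> borel_measurable (gauss_mat n p)" if "e \<in> {..<n} \<times> {..<p}" for e
    using measurable_gauss_mat_component[OF that] .
  show ?thesis unfolding spiked_stat_def by measurable
qed

lemma measurable_spiked_lik [measurable]: "spiked_lik n p r lmb V \<in> borel_measurable (gauss_mat n p)"
  unfolding spiked_lik_def by measurable

text \<open>V'V = I turns the squared norm of the conditional mean into lmb |u|^2. The exponent then
  separates over the entries of u, and integrating out U reduces to one-dimensional
  integrals.\<close>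

lemma spiked_mean_exponent:
  assumes V: "orth_frame p r V" and lmb: "0 \<le> lmb"
  shows "(\<Sum>e\<in>{..<n} \<times> {..<p}. spiked_mean r lmb V u e * x e - (spiked_mean r lmb V u e)\<^sup>2 / 2)
   = (\<Sum>e\<in>{..<n} \<times> {..<r}. (sqrt lmb * (\<Sum>k<p. x (fst e, k) * V k (snd e))) * u e - lmb * (u e)\<^sup>2 / 2)"
proof -
  have 1: "(\<Sum>k<p. spiked_mean r lmb V u (i, k) * x (i, k))
     = (\<Sum>j<r. (sqrt lmb * (\<Sum>k<p. x (i, k) * V k j)) * u (i, j))" for i
  proof -
    have "(\<Sum>k<p. spiked_mean r lmb V u (i, k) * x (i, k))
       = (\<Sum>k<p. \<Sum>j<r. sqrt lmb * (x (i, k) * V k j) * u (i, j))"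
      unfolding spiked_mean_def prod.case sum_distrib_right by (simp add: mult_ac)
    also have "\<dots> = (\<Sum>j<r. \<Sum>k<p. sqrt lmb * (x (i, k) * V k j) * u (i, j))" by (rule sum.swap)
    finally show ?thesis by (simp add: sum_distrib_left sum_distrib_right)
  qed
  have 2: "(\<Sum>k<p. (spiked_mean r lmb V u (i, k))\<^sup>2) = (\<Sum>j<r. lmb * (u (i, j))\<^sup>2)" for i
  proof -
    have "(\<Sum>k<p. (spiked_mean r lmb V u (i, k))\<^sup>2)
       = (\<Sum>k<p. \<Sum>j<r. \<Sum>l<r. V k j * V k l * ((sqrt lmb * sqrt lmb) * (u (i, j) * u (i, l))))"
      unfolding spiked_mean_def prod.case power2_eq_square sum_product by (simp only: mult_ac)
    also have "\<dots> = (\<Sum>j<r. \<Sum>k<p. \<Sum>l<r. V k j * V k l * ((sqrt lmb * sqrt lmb) * (u (i, j) * u (i, l))))"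
      by (rule sum.swap)
    also have "\<dots> = (\<Sum>j<r. \<Sum>l<r. \<Sum>k<p. V k j * V k l * ((sqrt lmb * sqrt lmb) * (u (i, j) * u (i, l))))"
      by (rule sum.cong[OF refl]) (rule sum.swap)
    also have "\<dots> = (\<Sum>j<r. \<Sum>l<r. if j = l then lmb * (u (i, j) * u (i, l)) else 0)"
      using V lmb by (intro sum.cong refl) (simp add: sum_distrib_right[symmetric] orth_frame_def)
    finally show ?thesis by (simp add: power2_eq_square)
  qed
  have "(\<Sum>e\<in>{..<n} \<times> {..<p}. spiked_mean r lmb V u e * x e - (spiked_mean r lmb V u e)\<^sup>2 / 2)
     = (\<Sum>i<n. (\<Sum>k<p. spiked_mean r lmb V u (i, k) * x (i, k)) - (\<Sum>k<p. (spiked_mean r lmb V u (i, k))\<^sup>2) / 2)"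
    by (simp add: sum.cartesian_product' sum_subtractf sum_divide_distrib)
  then show ?thesis
    by (simp add: 1 2 sum.cartesian_product' sum_subtractf sum_divide_distrib)
qed

lemma spiked_lik_integral:
  assumes "0 \<le> lmb"
  shows "(\<integral>\<^sup>+u. ennreal (exp (\<Sum>e\<in>{..<n} \<times> {..<r}. (sqrt lmb * (\<Sum>k<p. x (fst e, k) * V k (snd e))) * u e
      - lmb * (u e)\<^sup>2 / 2)) \<partial>gauss_mat n r) = ennreal (spiked_lik n p r lmb V x)"
proof -
  let ?y = "\<lambda>e. sqrt lmb * (\<Sum>k<p. x (fst e, k) * V k (snd e))"
  have "(\<integral>\<^sup>+u. ennreal (exp (\<Sum>e\<in>{..<n} \<times> {..<r}. ?y e * u e - lmb * (u e)\<^sup>2 / 2)) \<partial>gauss_mat n r)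
     = (\<integral>\<^sup>+u. (\<Prod>e\<in>{..<n} \<times> {..<r}. ennreal (exp (?y e * u e - lmb * (u e)\<^sup>2 / 2))) \<partial>gauss_mat n r)"
    by (simp add: exp_sum prod_ennreal)
  also have "\<dots> = (\<Prod>e\<in>{..<n} \<times> {..<r}. \<integral>\<^sup>+u. ennreal (exp (?y e * u - lmb * u\<^sup>2 / 2)) \<partial>std_gauss)"
    by (intro std_gauss_prod.product_nn_integral_prod) auto
  also have "\<dots> = (\<Prod>e\<in>{..<n} \<times> {..<r}. ennreal (1 / sqrt (1 + lmb) * exp ((?y e)\<^sup>2 / (2 * (1 + lmb)))))"
    using assms by (simp add: std_gauss_exp_quadratic)
  also have "\<dots> = ennreal (\<Prod>e\<in>{..<n} \<times> {..<r}. 1 / sqrt (1 + lmb) * exp ((?y e)\<^sup>2 / (2 * (1 + lmb))))"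
    using assms by (intro prod_ennreal) auto
  also have "(\<Prod>e\<in>{..<n} \<times> {..<r}. 1 / sqrt (1 + lmb) * exp ((?y e)\<^sup>2 / (2 * (1 + lmb))))
     = (1 / sqrt (1 + lmb)) ^ (n * r) * exp (\<Sum>e\<in>{..<n} \<times> {..<r}. (?y e)\<^sup>2 / (2 * (1 + lmb)))"
    unfolding prod.distrib by (simp add: exp_sum)
  also have "(\<Sum>e\<in>{..<n} \<times> {..<r}. (?y e)\<^sup>2 / (2 * (1 + lmb))) = lmb / (2 * (1 + lmb)) * spiked_stat n p r V x"
  proof -
    have "(?y e)\<^sup>2 / (2 * (1 + lmb)) = lmb / (2 * (1 + lmb)) * (\<Sum>k<p. x (fst e, k) * V k (snd e))\<^sup>2" for e
      using assms by (simp add: power_mult_distrib)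
    then show ?thesis
      by (simp only: spiked_stat_def sum.cartesian_product' sum_distrib_left fst_conv snd_conv)
  qed
  finally show ?thesis by (simp add: spiked_lik_def)
qed

text \<open>Given U = u, the shift formula supplies a density of X with respect to the law of Z.
  Tonelli moves the integral over u inside, where \<open>spiked_lik_integral\<close> evaluates
  it.\<close>

lemma distr_spiked_X:
  assumes V: "orth_frame p r V" and lmb: "0 \<le> lmb"
  shows "distr (noise_space n p r) (gauss_mat n p) (spiked_X n p r V (\<lambda>_. lmb))
    = density (gauss_mat n p) (\<lambda>x. ennreal (spiked_lik n p r lmb V x))" (is "?D = ?E")
proof (rule measure_eqI)
  fix A assume "A \<in> sets ?D"
  then have A [measurable]: "A \<in> sets (gauss_mat n p)" by simp
  let ?X = "spiked_X n p r V (\<lambda>_. lmb)" and ?I = "{..<n} \<times> {..<p}"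
  let ?m = "spiked_mean r lmb V"
  let ?g = "\<lambda>u x. ennreal (exp (\<Sum>e\<in>?I. ?m u e * x e - (?m u e)\<^sup>2 / 2))"
  interpret pair_sigma_finite "gauss_mat n r" "gauss_mat n p" by (rule pair_sigma_finite_gauss_mat)
  have X [measurable]: "?X \<in> measurable (gauss_mat n r \<Otimes>\<^sub>M gauss_mat n p) (gauss_mat n p)"
    using measurable_spiked_X[of n p r V lmb]
    by (simp add: noise_space_def measurable_cong_sets[OF refl sets_gauss_mat])
  have g: "(\<lambda>(u, x). ?g u x * indicator A x) \<in> borel_measurable (gauss_mat n r \<Otimes>\<^sub>M gauss_mat n p)"
  proof -
    have [measurable]: "(\<lambda>u. ?m u e) \<in> borel_measurable (gauss_mat n r)"
      "(\<lambda>z. z e) \<in> borel_measurable (gauss_mat n p)" if "e \<in> ?I" for e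
      using measurable_spiked_mean[OF that] measurable_gauss_mat_component[OF that] by auto
    show ?thesis by measurable
  qed
  have "emeasure ?D A = (\<integral>\<^sup>+x. indicator A x \<partial>?D)"
    using A by simp
  also have "\<dots> = (\<integral>\<^sup>+\<omega>. indicator A (?X \<omega>) \<partial>noise_space n p r)"
    unfolding noise_space_def by (intro nn_integral_distr) measurable
  also have "\<dots> = (\<integral>\<^sup>+u. \<integral>\<^sup>+z. indicator A (?X (u, z)) \<partial>gauss_mat n p \<partial>gauss_mat n r)"
    unfolding noise_space_def by (intro sigma_finite_measure.nn_integral_fst[OF prob_space_imp_sigma_finite[OF prob_space_gauss_mat], symmetric]) measurable
  also have "\<dots> = (\<integral>\<^sup>+u. \<integral>\<^sup>+x. ?g u x * indicator A x \<partial>gauss_mat n p \<partial>gauss_mat n r)"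
  proof (rule nn_integral_cong)
    fix u
    have [measurable]: "(\<lambda>z. \<lambda>e\<in>?I. ?m u e + z e) \<in> measurable (gauss_mat n p) (gauss_mat n p)"
      by (intro measurable_restrict) measurable
    have "(\<integral>\<^sup>+z. indicator A (?X (u, z)) \<partial>gauss_mat n p)
       = (\<integral>\<^sup>+x. indicator A x \<partial>distr (gauss_mat n p) (gauss_mat n p) (\<lambda>z. \<lambda>e\<in>?I. ?m u e + z e))"
      by (subst nn_integral_distr) (auto simp: spiked_X_eq)
    also have "\<dots> = (\<integral>\<^sup>+x. (\<Prod>e\<in>?I. ennreal (exp (?m u e * x e - (?m u e)\<^sup>2 / 2))) * indicator A x \<partial>gauss_mat n p)"
      by (subst PiM_std_gauss_shift, simp, subst nn_integral_density) auto
    also have "\<dots> = (\<integral>\<^sup>+x. ?g u x * indicator A x \<partial>gauss_mat n p)"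
      by (simp add: exp_sum prod_ennreal)
    finally show "(\<integral>\<^sup>+z. indicator A (?X (u, z)) \<partial>gauss_mat n p) = (\<integral>\<^sup>+x. ?g u x * indicator A x \<partial>gauss_mat n p)" .
  qed
  also have "\<dots> = (\<integral>\<^sup>+x. \<integral>\<^sup>+u. ?g u x * indicator A x \<partial>gauss_mat n r \<partial>gauss_mat n p)"
    using Fubini'[OF g] by simp
  also have "\<dots> = (\<integral>\<^sup>+x. ennreal (spiked_lik n p r lmb V x) * indicator A x \<partial>gauss_mat n p)"
  proof (rule nn_integral_cong)
    fix x
    have "(\<lambda>u. ?g u x) \<in> borel_measurable (gauss_mat n r)"
    proof -
      have [measurable]: "(\<lambda>u. ?m u e) \<in> borel_measurable (gauss_mat n r)" if "e \<in> ?I" for e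
        using measurable_spiked_mean[OF that] .
      show ?thesis by measurable
    qed
    then show "(\<integral>\<^sup>+u. ?g u x * indicator A x \<partial>gauss_mat n r) = ennreal (spiked_lik n p r lmb V x) * indicator A x"
      by (simp add: nn_integral_multc spiked_mean_exponent[OF V lmb] spiked_lik_integral[OF lmb])
  qed
  also have "\<dots> = emeasure ?E A" by (simp add: emeasure_density)
  finally show "emeasure ?D A = emeasure ?E A" .
qed simp

lemma spiked_lik_pos: "0 \<le> lmb \<Longrightarrow> 0 < spiked_lik n p r lmb V x"
  by (simp add: spiked_lik_def)

text \<open>Moves expectations from the likelihood to the noise space, where X is an explicit linear
  function of Gaussians. Relative entropy thereby reduces to second moments.\<close>

lemma integrable_spiked_lik_mult_iff:
  assumes V: "orth_frame p r V" and lmb: "0 \<le> lmb" and [measurable]: "f \<in> borel_measurable (gauss_mat n p)"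
  shows "integrable (gauss_mat n p) (\<lambda>x. spiked_lik n p r lmb V x * f x)
     \<longleftrightarrow> integrable (noise_space n p r) (\<lambda>\<omega>. f (spiked_X n p r V (\<lambda>_. lmb) \<omega> :: nat \<times> nat \<Rightarrow> real) :: real)"
    and "(\<integral>x. spiked_lik n p r lmb V x * f x \<partial>gauss_mat n p)
     = (\<integral>\<omega>. f (spiked_X n p r V (\<lambda>_. lmb) \<omega>) \<partial>noise_space n p r)"
proof -
  have [measurable]: "spiked_X n p r V (\<lambda>_. lmb) \<in> measurable (noise_space n p r) (gauss_mat n p)"
    using measurable_spiked_X by (simp add: measurable_cong_sets[OF refl sets_gauss_mat])
  have nn: "AE x in gauss_mat n p. 0 \<le> spiked_lik n p r lmb V x"
    using spiked_lik_pos[OF lmb] by (intro always_eventually allI) (simp add: less_imp_le)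
  show "integrable (gauss_mat n p) (\<lambda>x. spiked_lik n p r lmb V x * f x)
     \<longleftrightarrow> integrable (noise_space n p r) (\<lambda>\<omega>. f (spiked_X n p r V (\<lambda>_. lmb) \<omega>))"
    using integrable_density[of f "gauss_mat n p" "spiked_lik n p r lmb V", OF _ _ nn]
      integrable_distr_eq[of "spiked_X n p r V (\<lambda>_. lmb)" "noise_space n p r" "gauss_mat n p" f]
    by (simp add: distr_spiked_X[OF V lmb])
  show "(\<integral>x. spiked_lik n p r lmb V x * f x \<partial>gauss_mat n p)
     = (\<integral>\<omega>. f (spiked_X n p r V (\<lambda>_. lmb) \<omega>) \<partial>noise_space n p r)"
    using integral_density[of f "gauss_mat n p" "spiked_lik n p r lmb V", OF _ _ nn]
      integral_distr[of "spiked_X n p r V (\<lambda>_. lmb)" "noise_space n p r" "gauss_mat n p" f]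
    by (simp add: distr_spiked_X[OF V lmb])
qed

text \<open>Row i of X applied to w is a linear form in U plus an independent one in Z, and the
  value is w'(lmb VV' + I)w. Integrating the square as a nonnegative function gives integrability
  together with the value.\<close>

lemma spiked_X_linear_square:
  assumes "i < n" and lmb: "0 \<le> lmb"
  shows "has_bochner_integral (noise_space n p r)
    (\<lambda>\<omega>. (\<Sum>k<p. spiked_X n p r V (\<lambda>_. lmb) \<omega> (i, k) * w k)\<^sup>2)
    (lmb * (\<Sum>j<r. (\<Sum>k<p. V k j * w k)\<^sup>2) + (\<Sum>k<p. (w k)\<^sup>2))" (is "has_bochner_integral _ ?f ?s")
proof (rule has_bochner_integral_nn_integral)
  interpret pair_sigma_finite "gauss_mat n r" "gauss_mat n p" by (rule pair_sigma_finite_gauss_mat)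
  define c where "c j = sqrt lmb * (\<Sum>k<p. V k j * w k)" for j
  have f_eq: "?f (u, z) = ((\<Sum>e\<in>{i} \<times> {..<r}. c (snd e) * u e) + (\<Sum>e\<in>{i} \<times> {..<p}. w (snd e) * z e))\<^sup>2" for u z
  proof -
    have "(\<Sum>k<p. \<Sum>j<r. u (i, j) * sqrt lmb * V k j * w k) = (\<Sum>j<r. \<Sum>k<p. u (i, j) * sqrt lmb * V k j * w k)"
      by (rule sum.swap)
    also have "\<dots> = (\<Sum>j<r. c j * u (i, j))"
      by (simp add: c_def sum_distrib_left sum_distrib_right mult_ac)
    finally have "(\<Sum>k<p. (\<Sum>j<r. u (i, j) * sqrt lmb * V k j) * w k) = (\<Sum>j<r. c j * u (i, j))"
      by (simp only: sum_distrib_right)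
    then show ?thesis
      using assms(1) by (simp add: spiked_X_def sum.cartesian_product' distrib_right sum.distrib mult.commute[of "w _"])
  qed
  have X [measurable]: "(\<lambda>\<omega>. spiked_X n p r V (\<lambda>_. lmb) \<omega> (i, k)) \<in> borel_measurable (noise_space n p r)"
    if "k < p" for k
    using measurable_compose[OF measurable_spiked_X[unfolded data_space_def] measurable_component_singleton[of "(i, k)" "{..<n} \<times> {..<p}" "\<lambda>_. borel"]]
      that assms(1) by simp
  show f: "?f \<in> borel_measurable (noise_space n p r)" by measurable
  show s: "0 \<le> ?s" using lmb by (intro add_nonneg_nonneg mult_nonneg_nonneg sum_nonneg) auto
  show "AE \<omega> in noise_space n p r. 0 \<le> ?f \<omega>" by simp
  let ?w = "\<Sum>e\<in>{i} \<times> {..<p}. (w (snd e))\<^sup>2"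
  have "(\<integral>\<^sup>+\<omega>. ennreal (?f \<omega>) \<partial>noise_space n p r) = (\<integral>\<^sup>+u. \<integral>\<^sup>+z. ennreal (?f (u, z)) \<partial>gauss_mat n p \<partial>gauss_mat n r)"
    using f unfolding noise_space_def by (intro sigma_finite_measure.nn_integral_fst[OF prob_space_imp_sigma_finite[OF prob_space_gauss_mat], symmetric]) simp
  also have "\<dots> = (\<integral>\<^sup>+u. ennreal ((\<Sum>e\<in>{i} \<times> {..<r}. c (snd e) * u e)\<^sup>2 + ?w) \<partial>gauss_mat n r)"
  proof (rule nn_integral_cong)
    fix u
    have "has_bochner_integral (gauss_mat n p) (\<lambda>z. ?f (u, z)) ((\<Sum>e\<in>{i} \<times> {..<r}. c (snd e) * u e)\<^sup>2 + ?w)"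
      unfolding f_eq using assms(1) by (intro PiM_std_gauss_affine_square) auto
    then show "(\<integral>\<^sup>+z. ennreal (?f (u, z)) \<partial>gauss_mat n p) = ennreal ((\<Sum>e\<in>{i} \<times> {..<r}. c (snd e) * u e)\<^sup>2 + ?w)"
      by (subst nn_integral_eq_integral) (auto simp: has_bochner_integral_iff)
  qed
  also have "\<dots> = ennreal ((0\<^sup>2 + (\<Sum>e\<in>{i} \<times> {..<r}. (c (snd e))\<^sup>2)) + ?w)"
  proof -
    have "has_bochner_integral (gauss_mat n r) (\<lambda>u. (0 + (\<Sum>e\<in>{i} \<times> {..<r}. c (snd e) * u e))\<^sup>2)
        (0\<^sup>2 + (\<Sum>e\<in>{i} \<times> {..<r}. (c (snd e))\<^sup>2))"
      using assms(1) by (intro PiM_std_gauss_affine_square) auto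
    moreover have "has_bochner_integral (gauss_mat n r) (\<lambda>_. ?w) ?w"
      using prob_space.prob_space[OF prob_space_gauss_mat, of n r] by (simp add: has_bochner_integral_iff)
    ultimately have "has_bochner_integral (gauss_mat n r)
        (\<lambda>u. (0 + (\<Sum>e\<in>{i} \<times> {..<r}. c (snd e) * u e))\<^sup>2 + ?w) ((0\<^sup>2 + (\<Sum>e\<in>{i} \<times> {..<r}. (c (snd e))\<^sup>2)) + ?w)"
      by (rule has_bochner_integral_add)
    then show ?thesis
      by (subst nn_integral_eq_integral) (auto simp: has_bochner_integral_iff intro!: sum_nonneg add_nonneg_nonneg)
  qed
  also have "(0\<^sup>2 + (\<Sum>e\<in>{i} \<times> {..<r}. (c (snd e))\<^sup>2)) + ?w = ?s"
  proof -
    have "(c j)\<^sup>2 = lmb * (\<Sum>k<p. V k j * w k)\<^sup>2" for j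
      using lmb by (simp add: c_def power_mult_distrib)
    then show ?thesis by (simp add: sum.cartesian_product' sum_distrib_left)
  qed
  finally show "(\<integral>\<^sup>+\<omega>. ennreal (?f \<omega>) \<partial>noise_space n p r) = ennreal ?s" .
qed

lemma spiked_stat_expectation:
  assumes W: "orth_frame p r W" and lmb: "0 \<le> lmb"
  shows "has_bochner_integral (noise_space n p r)
    (\<lambda>\<omega>. spiked_stat n p r W (spiked_X n p r V (\<lambda>_. lmb) \<omega>))
    (real n * (lmb * (\<Sum>j<r. \<Sum>l<r. (\<Sum>k<p. V k j * W k l)\<^sup>2) + real r))"
proof -
  have "has_bochner_integral (noise_space n p r)
    (\<lambda>\<omega>. spiked_stat n p r W (spiked_X n p r V (\<lambda>_. lmb) \<omega>))
    (\<Sum>i<n. \<Sum>l<r. lmb * (\<Sum>j<r. (\<Sum>k<p. V k j * W k l)\<^sup>2) + (\<Sum>k<p. (W k l)\<^sup>2))"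
    unfolding spiked_stat_def
    by (intro has_bochner_integral_sum spiked_X_linear_square lmb) auto
  also have "(\<Sum>i<n. \<Sum>l<r. lmb * (\<Sum>j<r. (\<Sum>k<p. V k j * W k l)\<^sup>2) + (\<Sum>k<p. (W k l)\<^sup>2))
    = (\<Sum>i<n. \<Sum>l<r. lmb * (\<Sum>j<r. (\<Sum>k<p. V k j * W k l)\<^sup>2) + 1)"
    using W by (intro sum.cong refl) (simp add: orth_frame_def power2_eq_square)
  also have "\<dots> = real n * (lmb * (\<Sum>l<r. \<Sum>j<r. (\<Sum>k<p. V k j * W k l)\<^sup>2) + real r)"
    by (simp add: sum.distrib sum_distrib_left)
  also have "(\<Sum>l<r. \<Sum>j<r. (\<Sum>k<p. V k j * W k l)\<^sup>2) = (\<Sum>j<r. \<Sum>l<r. (\<Sum>k<p. V k j * W k l)\<^sup>2)"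
    by (rule sum.swap)
  finally show ?thesis .
qed

subsection \<open>Testing and Assouad's scheme\<close>

lemma spiked_lik_integral_1:
  assumes "orth_frame p r V" "0 \<le> lmb"
  shows "integrable (gauss_mat n p) (spiked_lik n p r lmb V)"
    and "(\<integral>x. spiked_lik n p r lmb V x \<partial>gauss_mat n p) = 1"
proof -
  interpret noise: prob_space "noise_space n p r" by (rule prob_space_noise)
  show "integrable (gauss_mat n p) (spiked_lik n p r lmb V)"
    using integrable_spiked_lik_mult_iff(1)[OF assms, where f = "\<lambda>_. 1" and n = n] by simp
  show "(\<integral>x. spiked_lik n p r lmb V x \<partial>gauss_mat n p) = 1"
    using integrable_spiked_lik_mult_iff(2)[OF assms, where f = "\<lambda>_. 1" and n = n] noise.prob_space by simp
qed

lemma ln_spiked_lik_ratio: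
  assumes "0 \<le> lmb"
  shows "ln (spiked_lik n p r lmb V x / spiked_lik n p r lmb W x)
     = lmb / (2 * (1 + lmb)) * (spiked_stat n p r V x - spiked_stat n p r W x)"
proof -
  have "spiked_lik n p r lmb V x / spiked_lik n p r lmb W x
     = exp (lmb / (2 * (1 + lmb)) * (spiked_stat n p r V x - spiked_stat n p r W x))"
    using assms by (simp add: spiked_lik_def exp_diff[symmetric] right_diff_distrib)
  then show ?thesis by simp
qed

text \<open>The normalising factors depend only on n, r and lmb and cancel in the ratio. What
  remains is lmb / (2(1 + lmb)) times a difference of statistics with expectation n lmb (r -
  |V'W|^2), and r - |V'W|^2 is half the loss.\<close>

lemma spiked_relative_entropy:
  assumes V: "orth_frame p r V" and W: "orth_frame p r W" and lmb: "0 \<le> lmb"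
  shows "has_bochner_integral (gauss_mat n p)
    (\<lambda>x. spiked_lik n p r lmb V x * ln (spiked_lik n p r lmb V x / spiked_lik n p r lmb W x))
    (real n * hfun lmb / 4 * proj_dist2 p r V W)"
proof -
  let ?X = "spiked_X n p r V (\<lambda>_. lmb)" and ?a = "lmb / (2 * (1 + lmb))"
  have "has_bochner_integral (noise_space n p r)
    (\<lambda>\<omega>. ?a * (spiked_stat n p r V (?X \<omega>) - spiked_stat n p r W (?X \<omega>)))
    (?a * (real n * (lmb * (\<Sum>j<r. \<Sum>l<r. (\<Sum>k<p. V k j * V k l)\<^sup>2) + real r)
       - real n * (lmb * (\<Sum>j<r. \<Sum>l<r. (\<Sum>k<p. V k j * W k l)\<^sup>2) + real r)))"
    by (intro has_bochner_integral_mult_right has_bochner_integral_diff spiked_stat_expectation assms)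
  also have "?a * (real n * (lmb * (\<Sum>j<r. \<Sum>l<r. (\<Sum>k<p. V k j * V k l)\<^sup>2) + real r)
       - real n * (lmb * (\<Sum>j<r. \<Sum>l<r. (\<Sum>k<p. V k j * W k l)\<^sup>2) + real r))
     = (lmb * ?a) * real n * (real r - (\<Sum>j<r. \<Sum>l<r. (\<Sum>k<p. V k j * W k l)\<^sup>2))"
    unfolding sum_orth_frame_square[OF V] by (simp only: algebra_simps)
  also have "\<dots> = real n * hfun lmb / 4 * proj_dist2 p r V W"
    unfolding proj_dist2_orth_frame[OF V W] hfun_def using lmb by (simp add: power2_eq_square[of lmb] field_simps)
  finally have expect: "has_bochner_integral (noise_space n p r)
    (\<lambda>\<omega>. ?a * (spiked_stat n p r V (?X \<omega>) - spiked_stat n p r W (?X \<omega>)))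
    (real n * hfun lmb / 4 * proj_dist2 p r V W)" .
  have measurable_diff: "(\<lambda>x. ?a * (spiked_stat n p r V x - spiked_stat n p r W x)) \<in> borel_measurable (gauss_mat n p)"
    by measurable
  note lik = integrable_spiked_lik_mult_iff[OF V lmb measurable_diff]
  show ?thesis
    using expect unfolding has_bochner_integral_iff ln_spiked_lik_ratio[OF lmb] lik .
qed

text \<open>Where f \<le> t g the first term suffices; elsewhere ln(f / g) exceeds ln t, so f is at
  most the entropy integrand divided by ln t. Adding g makes that integrand nonnegative everywhere,
  which allows integrating it over the whole space at the price of the mass of g.\<close>

lemma integral_indicator_le_relative_entropy:
  fixes f g :: "'a \<Rightarrow> real"
  assumes f: "integrable M f" "\<And>x. 0 < f x" and g: "integrable M g" "\<And>x. 0 < g x"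
    and fg: "integrable M (\<lambda>x. f x * ln (f x / g x))" and A: "A \<in> sets M" and t: "1 < t"
  shows "(\<integral>x. f x * indicator A x \<partial>M)
    \<le> t * (\<integral>x. g x * indicator A x \<partial>M) + ((\<integral>x. f x * ln (f x / g x) \<partial>M) + (\<integral>x. g x \<partial>M)) / ln t"
proof -
  have ptw: "f x * indicator A x \<le> t * (g x * indicator A x) + (f x * ln (f x / g x) + g x) / ln t" for x
  proof -
    define s where "s = f x / g x"
    have s: "0 < s" "f x = s * g x" using f(2)[of x] g(2)[of x] by (auto simp: s_def)
    have lnt: "ln t > 0" using t by simp
    \<comment> \<open>Multiplied by s this is s - 1 \<le> s ln s, the source of
      nonnegativity.\<close>
    have "ln (1 / s) \<le> 1 / s - 1" using s by (intro ln_le_minus_one) simp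
    then have "s * (- ln s) \<le> s * (1 / s - 1)"
      using s(1) by (intro mult_left_mono) (auto simp: ln_div)
    then have "s - 1 \<le> s * ln s"
      using s(1) by (simp add: right_diff_distrib)
    then have "0 \<le> g x * (s * ln s + 1)" using s g(2)[of x] by (intro mult_nonneg_nonneg) auto
    then have nn: "0 \<le> f x * ln s + g x" by (simp add: s(2) algebra_simps)
    show ?thesis
    proof (cases "s \<le> t")
      case True
      then have "f x * indicator A x \<le> t * (g x * indicator A x)"
        using s g(2)[of x] by (auto simp: indicator_def)
      then show ?thesis using nn lnt by (simp add: s_def[symmetric] add_increasing2)
    next
      case False
      then have "ln t \<le> ln s" using s t by simp
      then have "f x * ln t \<le> f x * ln s"
        using f(2)[of x] by (intro mult_left_mono) auto
      then have "f x * ln t \<le> f x * ln s + g x" using g(2)[of x] by linarith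
      then have "f x \<le> (f x * ln s + g x) / ln t" using lnt by (simp add: field_simps)
      moreover have "f x * indicator A x \<le> f x" using f(2)[of x] by (auto simp: indicator_def)
      moreover have "0 \<le> t * (g x * indicator A x)" using t g(2)[of x] by (auto simp: indicator_def)
      ultimately show ?thesis by (simp add: s_def)
    qed
  qed
  have iA: "integrable M (\<lambda>x. f x * indicator A x)" "integrable M (\<lambda>x. g x * indicator A x)"
    by (intro integrable_real_mult_indicator A f(1) g(1))+
  have "(\<integral>x. f x * indicator A x \<partial>M) \<le> (\<integral>x. t * (g x * indicator A x) + (f x * ln (f x / g x) + g x) / ln t \<partial>M)"
    by (intro integral_mono ptw iA Bochner_Integration.integrable_add integrable_mult_right integrable_divide fg g(1))
  also have "\<dots> = t * (\<integral>x. g x * indicator A x \<partial>M) + ((\<integral>x. f x * ln (f x / g x) \<partial>M) + (\<integral>x. g x \<partial>M)) / ln t"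
    using iA fg g(1) by simp
  finally show ?thesis .
qed

definition spiked_prob :: "nat \<Rightarrow> nat \<Rightarrow> nat \<Rightarrow> real \<Rightarrow> (nat \<Rightarrow> nat \<Rightarrow> real) \<Rightarrow> (nat \<times> nat \<Rightarrow> real) set \<Rightarrow> real" where
  "spiked_prob n p r lmb V A = (\<integral>\<omega>. indicator A (spiked_X n p r V (\<lambda>_. lmb) \<omega>) \<partial>noise_space n p r)"

lemma integrable_spiked_indicator:
  assumes "A \<in> sets (data_space n p)"
  shows "integrable (noise_space n p r) (\<lambda>\<omega>. indicator A (spiked_X n p r V (\<lambda>_. lmb) \<omega>) :: real)"
proof -
  interpret noise: prob_space "noise_space n p r" by (rule prob_space_noise)
  show ?thesis
    using measurable_compose[OF measurable_spiked_X borel_measurable_indicator[OF assms]]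
    by (intro noise.integrable_const_bound[where B = 1]) (auto simp: indicator_def)
qed

lemma spiked_prob_le:
  assumes V: "orth_frame p r V" and W: "orth_frame p r W" and lmb: "0 \<le> lmb"
    and A: "A \<in> sets (data_space n p)" and t: "1 < t"
  shows "spiked_prob n p r lmb V A
    \<le> t * spiked_prob n p r lmb W A + (real n * hfun lmb / 4 * proj_dist2 p r V W + 1) / ln t"
proof -
  have A': "A \<in> sets (gauss_mat n p)" using A by (simp add: sets_gauss_mat)
  have eq: "spiked_prob n p r lmb V A = (\<integral>x. spiked_lik n p r lmb V x * indicator A x \<partial>gauss_mat n p)"
    if "orth_frame p r V" for V
    using integrable_spiked_lik_mult_iff(2)[OF that lmb, where f = "indicator A" and n = n] A'
    by (simp add: spiked_prob_def)
  show ?thesis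
    using integral_indicator_le_relative_entropy[OF spiked_lik_integral_1(1)[OF V lmb] spiked_lik_pos[OF lmb]
        spiked_lik_integral_1(1)[OF W lmb] spiked_lik_pos[OF lmb]
        has_bochner_integral_iff[THEN iffD1, THEN conjunct1, OF spiked_relative_entropy[OF V W lmb]] A' t]
    unfolding eq[OF V] eq[OF W] spiked_lik_integral_1(2)[OF W lmb]
      has_bochner_integral_iff[THEN iffD1, THEN conjunct2, OF spiked_relative_entropy[OF V W lmb]] .
qed

lemma sum_spiked_prob_disjoint:
  assumes "finite S" "disjoint_family_on A S" "\<And>b. b \<in> S \<Longrightarrow> A b \<in> sets (data_space n p)"
  shows "(\<Sum>b\<in>S. spiked_prob n p r lmb V (A b)) \<le> 1"
proof -
  interpret noise: prob_space "noise_space n p r" by (rule prob_space_noise)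
  let ?X = "spiked_X n p r V (\<lambda>_. lmb)"
  have le: "(\<Sum>b\<in>S. indicator (A b) x) \<le> (1::real)" for x
  proof (cases "\<exists>b\<in>S. x \<in> A b")
    case True
    then obtain b where b: "b \<in> S" "x \<in> A b" by auto
    have "(\<Sum>b'\<in>S. indicator (A b') x) = (\<Sum>b'\<in>S. if b' = b then 1 else 0 :: real)"
      using b assms(2) by (intro sum.cong refl) (auto simp: disjoint_family_on_def indicator_def)
    then show ?thesis using assms(1) b by simp
  next
    case False
    then show ?thesis by (simp add: indicator_def)
  qed
  have "(\<Sum>b\<in>S. spiked_prob n p r lmb V (A b)) = (\<integral>\<omega>. (\<Sum>b\<in>S. indicator (A b) (?X \<omega>)) \<partial>noise_space n p r)"
    unfolding spiked_prob_def
    by (intro Bochner_Integration.integral_sum[symmetric] integrable_spiked_indicator assms)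
  also have "\<dots> \<le> 1"
    using assms(3) by (intro noise.integral_le_const le always_eventually allI
        Bochner_Integration.integrable_sum integrable_spiked_indicator) auto
  finally show ?thesis .
qed

text \<open>Hypothesis 0 is the common reference: under it the disjoint sets have total probability
  at most 1. With t = B / 4 they contribute at most B / 4, and the condition on K limits each
  entropy term to 1/2, so the average success probability is at most 3/4.\<close>

lemma sum_spiked_prob_test_le:
  assumes V: "\<And>b. b < B \<Longrightarrow> orth_frame p r (V b)" and lmb: "0 \<le> lmb"
    and A: "\<And>b. b < B \<Longrightarrow> A b \<in> sets (data_space n p)" "disjoint_family_on A {..<B}"
    and K: "\<And>b. b < B \<Longrightarrow> real n * hfun lmb / 4 * proj_dist2 p r (V b) (V 0) \<le> K"
    and B: "0 \<le> K" "4 < real B" "2 * (K + 1) \<le> ln (real B / 4)"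
  shows "(\<Sum>b<B. spiked_prob n p r lmb (V b) (A b)) \<le> 3 / 4 * real B"
proof -
  define t where "t = real B / 4"
  have t: "1 < t" "2 * (K + 1) \<le> ln t" using B by (auto simp: t_def)
  have B0: "0 < B" using B(2) by (cases B) auto
  have "spiked_prob n p r lmb (V b) (A b) \<le> t * spiked_prob n p r lmb (V 0) (A b) + 1 / 2" if b: "b < B" for b
  proof -
    have "spiked_prob n p r lmb (V b) (A b) \<le> t * spiked_prob n p r lmb (V 0) (A b)
       + (real n * hfun lmb / 4 * proj_dist2 p r (V b) (V 0) + 1) / ln t"
      by (rule spiked_prob_le[OF V[OF b] V[OF B0] lmb A(1)[OF b] t(1)])
    also have "(real n * hfun lmb / 4 * proj_dist2 p r (V b) (V 0) + 1) / ln t \<le> 1 / 2"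
      using K[OF b] t B(1) by (simp add: field_simps)
    finally show ?thesis by simp
  qed
  then have "(\<Sum>b<B. spiked_prob n p r lmb (V b) (A b)) \<le> (\<Sum>b<B. t * spiked_prob n p r lmb (V 0) (A b) + 1 / 2)"
    by (intro sum_mono) auto
  also have "\<dots> = t * (\<Sum>b<B. spiked_prob n p r lmb (V 0) (A b)) + real B / 2"
    by (simp add: sum.distrib sum_distrib_left)
  also have "(\<Sum>b<B. spiked_prob n p r lmb (V 0) (A b)) \<le> 1"
    using A by (intro sum_spiked_prob_disjoint) auto
  finally show ?thesis using t by (simp add: t_def)
qed

section \<open>Measurability and boundedness of the loss of an estimator\<close>

lemma spiked_X_in_space: "spiked_X n p r V lam \<omega> \<in> space (data_space n p)"
proof -
  have "spiked_X n p r V lam \<omega> e = undefined" if "e \<notin> {..<n} \<times> {..<p}" for e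
    using that by (cases e) (auto simp: spiked_X_def)
  then show ?thesis unfolding data_space_def space_PiM by (intro PiE_I) simp_all
qed

lemma estimator_orth:
  "Vh \<in> estimators n p r \<Longrightarrow> orth_frame p r (Vh (spiked_X n p r V lam \<omega>))"
  unfolding estimators_def mem_Collect_eq by (rule bspec[OF conjunct1 spiked_X_in_space])

lemma measurable_projm_estimator:
  assumes "Vh \<in> estimators n p r"
  shows "(\<lambda>x. projm r (Vh x) i k) \<in> borel_measurable (data_space n p)"
proof -
  have [measurable]: "(\<lambda>x. Vh x i j) \<in> borel_measurable (data_space n p)" for i j
    using assms by (simp add: estimators_def)
  show ?thesis unfolding projm_def by measurable
qed

lemma integrable_estimator_loss:
  assumes Vh: "Vh \<in> estimators n p r" and V: "orth_frame p r V"
  shows "integrable (noise_space n p r) (\<lambda>\<omega>. proj_dist2 p r (Vh (spiked_X n p r V (\<lambda>_. lmb) \<omega>)) V)"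
proof -
  interpret noise: prob_space "noise_space n p r" by (rule prob_space_noise)
  note measurable_projm_estimator[OF Vh, measurable]
  have "(\<lambda>x. proj_dist2 p r (Vh x) V) \<in> borel_measurable (data_space n p)"
    unfolding proj_dist2_projm by measurable
  from measurable_compose[OF measurable_spiked_X this]
  show ?thesis
    by (rule noise.integrable_const_bound[where B = "4 * (real p)\<^sup>2", rotated])
      (simp only: real_norm_def abs_of_nonneg[OF proj_dist2_nonneg] proj_dist2_le[OF estimator_orth[OF Vh] V] eventually_True)
qed

text \<open>Here \<open>lam\<close> is arbitrary, while measurability of the model is established
  for equal spikes. A loss that is not integrable has Bochner integral 0 by convention, so the bound
  covers that case too.\<close>

lemma risk_le:
  assumes Vh: "Vh \<in> estimators n p r" and V: "orth_frame p r V"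
  shows "risk n p r Vh V lam \<le> 4 * (real p)\<^sup>2"
proof -
  interpret noise: prob_space "noise_space n p r" by (rule prob_space_noise)
  show ?thesis
  proof (cases "integrable (noise_space n p r) (\<lambda>\<omega>. proj_dist2 p r (Vh (spiked_X n p r V lam \<omega>)) V)")
    case True
    then show ?thesis unfolding risk_def
      by (intro noise.integral_le_const always_eventually allI proj_dist2_le estimator_orth Vh V)
  next
    case False
    then have "risk n p r Vh V lam = 0" unfolding risk_def by (rule not_integrable_integral_eq)
    then show ?thesis by simp
  qed
qed

lemma risk_nonneg: "0 \<le> risk n p r Vh V lam"
  unfolding risk_def by (intro integral_nonneg_AE always_eventually allI proj_dist2_nonneg)

text \<open>The cube splits into lines in direction i with B points each, and the hypothesis bounds
  the sum along every line.\<close>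

lemma sum_PiE_coordinate_le:
  fixes F :: "('i \<Rightarrow> nat) \<Rightarrow> real"
  assumes I: "finite I" "i \<in> I" and B: "0 < B"
    and F: "\<And>\<theta>. \<theta> \<in> I \<rightarrow>\<^sub>E {..<B} \<Longrightarrow> (\<Sum>b<B. F (\<theta>(i := b))) \<le> c * real B"
  shows "(\<Sum>\<theta>\<in>I \<rightarrow>\<^sub>E {..<B}. F \<theta>) \<le> c * real (card (I \<rightarrow>\<^sub>E {..<B}))"
proof -
  let ?I = "I - {i}"
  have ins: "insert i ?I = I" using I by auto
  have inj: "inj_on (\<lambda>(y, g). g(i := y)) ({..<B} \<times> (?I \<rightarrow>\<^sub>E {..<B}))"
    using inj_combinator[of i ?I "\<lambda>_. {..<B}"] by simp
  have img: "I \<rightarrow>\<^sub>E {..<B} = (\<lambda>(y, g). g(i := y)) ` ({..<B} \<times> (?I \<rightarrow>\<^sub>E {..<B}))"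
    using PiE_insert_eq[of i ?I "\<lambda>_. {..<B}"] unfolding ins .
  have "(\<Sum>\<theta>\<in>I \<rightarrow>\<^sub>E {..<B}. F \<theta>) = (\<Sum>(y, g)\<in>{..<B} \<times> (?I \<rightarrow>\<^sub>E {..<B}). F (g(i := y)))"
    unfolding img by (subst sum.reindex[OF inj]) (simp add: case_prod_unfold)
  also have "\<dots> = (\<Sum>y<B. \<Sum>g\<in>?I \<rightarrow>\<^sub>E {..<B}. F (g(i := y)))"
    by (simp add: sum.cartesian_product)
  also have "\<dots> = (\<Sum>g\<in>?I \<rightarrow>\<^sub>E {..<B}. \<Sum>y<B. F (g(i := y)))"
    by (rule sum.swap)
  also have "\<dots> \<le> (\<Sum>g\<in>?I \<rightarrow>\<^sub>E {..<B}. c * real B)"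
  proof (rule sum_mono)
    fix g assume g: "g \<in> ?I \<rightarrow>\<^sub>E {..<B}"
    \<comment> \<open>The value 0 merely selects a point of the line; the later update at i
      overwrites it.\<close>
    then have "g(i := 0) \<in> I \<rightarrow>\<^sub>E {..<B}"
      using PiE_fun_upd[of 0 "\<lambda>_. {..<B}" i g ?I, unfolded ins] B by simp
    from F[OF this] show "(\<Sum>y<B. F (g(i := y))) \<le> c * real B" by simp
  qed
  also have "\<dots> = c * real (card (I \<rightarrow>\<^sub>E {..<B}))"
    unfolding img card_image[OF inj] by (simp add: card_cartesian_product)
  finally show ?thesis .
qed

text \<open>Coordinate \<open>i\<close> of \<open>\<theta>\<close> is visible in the block \<open>J i\<close> of the projection matrix, so the loss
splits into one \<open>B\<close>-ary testing problem per coordinate.\<close>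

lemma spiked_assouad:
  fixes V :: "('i \<Rightarrow> nat) \<Rightarrow> nat \<Rightarrow> nat \<Rightarrow> real"
  assumes I: "finite I" and Vh: "Vh \<in> estimators n p r" and lmb: "0 \<le> lmb" and \<eta>: "0 < \<eta>"
    and J: "\<And>i. i \<in> I \<Longrightarrow> J i \<subseteq> {..<p} \<times> {..<p}" "disjoint_family_on J I"
    and V: "\<And>\<theta>. \<theta> \<in> I \<rightarrow>\<^sub>E {..<B} \<Longrightarrow> orth_frame p r (V \<theta>)"
    and K: "\<And>\<theta> i b. \<theta> \<in> I \<rightarrow>\<^sub>E {..<B} \<Longrightarrow> i \<in> I \<Longrightarrow> b < B \<Longrightarrow>
       real n * hfun lmb / 4 * proj_dist2 p r (V (\<theta>(i := b))) (V (\<theta>(i := 0))) \<le> K"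
    and sep: "\<And>\<theta> i b b'. \<theta> \<in> I \<rightarrow>\<^sub>E {..<B} \<Longrightarrow> i \<in> I \<Longrightarrow> b < B \<Longrightarrow> b' < B \<Longrightarrow> b \<noteq> b' \<Longrightarrow>
       \<exists>e\<in>J i. \<eta> / 2 \<le> \<bar>projm r (V (\<theta>(i := b))) (fst e) (snd e) - projm r (V (\<theta>(i := b'))) (fst e) (snd e)\<bar>"
    and B: "0 \<le> K" "4 < real B" "2 * (K + 1) \<le> ln (real B / 4)"
  shows "\<exists>\<theta>\<in>I \<rightarrow>\<^sub>E {..<B}. real (card I) * \<eta>\<^sup>2 / 64 \<le> risk n p r Vh (V \<theta>) (\<lambda>_. lmb)"
proof -
  interpret noise: prob_space "noise_space n p r" by (rule prob_space_noise)
  \<comment> \<open>The square of \<eta> / 4: alternatives at least \<eta> / 2 apart in some entry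
    cannot both be closer than \<eta> / 4 to one estimate.\<close>
  define \<delta> where "\<delta> = \<eta>\<^sup>2 / 16"
  define \<Theta> where "\<Theta> = I \<rightarrow>\<^sub>E {..<B}"
  define loss where "loss i \<theta> x = (\<Sum>e\<in>J i. (projm r (Vh x) (fst e) (snd e) - projm r (V \<theta>) (fst e) (snd e))\<^sup>2)" for i \<theta> x
  define A where "A i \<theta> = {x \<in> space (data_space n p). loss i \<theta> x < \<delta>}" for i \<theta>
  let ?P = "\<lambda>i \<theta>. spiked_prob n p r lmb (V \<theta>) (A i \<theta>)"
  have B0: "0 < B" using B(2) by (cases B) auto
  have \<Theta>: "finite \<Theta>" "\<Theta> \<noteq> {}"
    using I B0 by (auto simp: \<Theta>_def PiE_eq_empty_iff intro: finite_PiE)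
  have finJ: "finite (J i)" if "i \<in> I" for i using J(1)[OF that] by (rule finite_subset) simp
  have measA: "A i \<theta> \<in> sets (data_space n p)" for i \<theta>
  proof -
    note measurable_projm_estimator[OF Vh, measurable]
    show ?thesis unfolding A_def loss_def by measurable
  qed
  \<comment> \<open>With the other coordinates fixed, the events that the estimate is close to
    alternative b on J i are disjoint and form a test between B hypotheses.\<close>
  have test: "(\<Sum>b<B. ?P i (\<theta>(i := b))) \<le> 3 / 4 * real B" if \<theta>: "\<theta> \<in> \<Theta>" and i: "i \<in> I" for \<theta> i
  proof (rule sum_spiked_prob_test_le)
    show "orth_frame p r (V (\<theta>(i := b)))" if "b < B" for b
      using PiE_fun_upd[of b "\<lambda>_. {..<B}" i \<theta> I] \<theta> i that by (intro V) (simp add: \<Theta>_def insert_absorb)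
    show "disjoint_family_on (\<lambda>b. A i (\<theta>(i := b))) {..<B}"
      unfolding disjoint_family_on_def
    proof (intro ballI impI)
      fix b b' assume b: "b \<in> {..<B}" "b' \<in> {..<B}" "b \<noteq> b'"
      have False if x: "x \<in> A i (\<theta>(i := b))" "x \<in> A i (\<theta>(i := b'))" for x
      proof -
        obtain e where e: "e \<in> J i" and far:
          "\<eta> / 2 \<le> \<bar>projm r (V (\<theta>(i := b))) (fst e) (snd e) - projm r (V (\<theta>(i := b'))) (fst e) (snd e)\<bar>"
          using sep[OF \<theta>[unfolded \<Theta>_def] i _ _ b(3)] b(1,2) unfolding lessThan_iff by blast
        have "\<bar>projm r (Vh x) (fst e) (snd e) - projm r (V (\<theta>(i := c))) (fst e) (snd e)\<bar> < \<eta> / 4"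
          if "x \<in> A i (\<theta>(i := c))" for c
        proof -
          have "(projm r (Vh x) (fst e) (snd e) - projm r (V (\<theta>(i := c))) (fst e) (snd e))\<^sup>2 \<le> loss i (\<theta>(i := c)) x"
            unfolding loss_def by (rule member_le_sum[OF e]) (auto simp: finJ[OF i])
          also have "\<dots> < (\<eta> / 4)\<^sup>2" using that by (simp add: A_def \<delta>_def power_divide)
          finally have "\<bar>projm r (Vh x) (fst e) (snd e) - projm r (V (\<theta>(i := c))) (fst e) (snd e)\<bar>\<^sup>2 < (\<eta> / 4)\<^sup>2"
            by simp
          then show ?thesis by (rule power2_less_imp_less) (use \<eta> in simp)
        qed
        from this[OF x(1)] this[OF x(2)] far show False by linarith
      qed
      then show "A i (\<theta>(i := b)) \<inter> A i (\<theta>(i := b')) = {}" by auto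
    qed
    show "real n * hfun lmb / 4 * proj_dist2 p r (V (\<theta>(i := b))) (V (\<theta>(i := 0))) \<le> K" if "b < B" for b
      by (rule K[OF \<theta>[unfolded \<Theta>_def] i that])
  qed (rule lmb measA B)+
  have risk: "(\<Sum>i\<in>I. \<delta> * (1 - ?P i \<theta>)) \<le> risk n p r Vh (V \<theta>) (\<lambda>_. lmb)" if \<theta>: "\<theta> \<in> \<Theta>" for \<theta>
  proof -
    let ?X = "spiked_X n p r (V \<theta>) (\<lambda>_. lmb)"
    \<comment> \<open>Outside A i the loss on block J i is at least \<delta>, and disjointness of
      the blocks lets these losses add up.\<close>
    have ptw: "(\<Sum>i\<in>I. \<delta> * (1 - indicator (A i \<theta>) x)) \<le> proj_dist2 p r (Vh x) (V \<theta>)"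
      if x: "x \<in> space (data_space n p)" for x
    proof -
      have "(\<Sum>i\<in>I. \<delta> * (1 - indicator (A i \<theta>) x)) \<le> (\<Sum>i\<in>I. loss i \<theta> x)"
      proof (rule sum_mono)
        fix i assume "i \<in> I"
        have "0 \<le> loss i \<theta> x" by (simp add: loss_def sum_nonneg)
        then show "\<delta> * (1 - indicator (A i \<theta>) x) \<le> loss i \<theta> x"
          using x by (auto simp: A_def indicator_def)
      qed
      also have "\<dots> = (\<Sum>e\<in>(\<Union>i\<in>I. J i). (projm r (Vh x) (fst e) (snd e) - projm r (V \<theta>) (fst e) (snd e))\<^sup>2)"
        unfolding loss_def using I finJ J(2)
        by (intro sum.UNION_disjoint[symmetric]) (auto simp: disjoint_family_on_def)
      also have "\<dots> \<le> (\<Sum>e\<in>{..<p} \<times> {..<p}. (projm r (Vh x) (fst e) (snd e) - projm r (V \<theta>) (fst e) (snd e))\<^sup>2)"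
        using J(1) by (intro sum_mono2) auto
      also have "\<dots> = proj_dist2 p r (Vh x) (V \<theta>)"
        by (simp add: proj_dist2_projm sum.cartesian_product')
      finally show ?thesis .
    qed
    have int: "integrable (noise_space n p r) (\<lambda>\<omega>. \<delta> * (1 - indicator (A i \<theta>) (?X \<omega>)))" for i
      using integrable_spiked_indicator[OF measA] by simp
    have "(\<Sum>i\<in>I. \<delta> * (1 - ?P i \<theta>)) = (\<Sum>i\<in>I. \<integral>\<omega>. \<delta> * (1 - indicator (A i \<theta>) (?X \<omega>)) \<partial>noise_space n p r)"
      using integrable_spiked_indicator[OF measA] noise.prob_space
      by (simp add: spiked_prob_def)
    also have "\<dots> = (\<integral>\<omega>. (\<Sum>i\<in>I. \<delta> * (1 - indicator (A i \<theta>) (?X \<omega>))) \<partial>noise_space n p r)"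
      by (intro Bochner_Integration.integral_sum[symmetric] int)
    also have "\<dots> \<le> risk n p r Vh (V \<theta>) (\<lambda>_. lmb)"
      unfolding risk_def
      by (intro integral_mono Bochner_Integration.integrable_sum int integrable_estimator_loss Vh ptw
          spiked_X_in_space V \<theta>[unfolded \<Theta>_def])
    finally show ?thesis .
  qed
  \<comment> \<open>On average over the cube each coordinate is missed with probability at least
    1/4, and \<delta> / 4 = \<eta>^2 / 64.\<close>
  have "real (card I) * (\<delta> / 4) * real (card \<Theta>) = (\<Sum>i\<in>I. \<delta> * (real (card \<Theta>) - 3 / 4 * real (card \<Theta>)))"
    by simp
  also have "\<dots> \<le> (\<Sum>i\<in>I. \<delta> * (real (card \<Theta>) - (\<Sum>\<theta>\<in>\<Theta>. ?P i \<theta>)))"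
  proof (intro sum_mono mult_left_mono diff_left_mono)
    fix i assume i: "i \<in> I"
    show "(\<Sum>\<theta>\<in>\<Theta>. ?P i \<theta>) \<le> 3 / 4 * real (card \<Theta>)"
      unfolding \<Theta>_def by (rule sum_PiE_coordinate_le[OF I i B0]) (rule test[unfolded \<Theta>_def, OF _ i])
  qed (simp add: \<delta>_def)
  also have "\<dots> = (\<Sum>i\<in>I. \<Sum>\<theta>\<in>\<Theta>. \<delta> * (1 - ?P i \<theta>))"
    by (simp add: sum_distrib_left[symmetric] sum_subtractf)
  also have "\<dots> = (\<Sum>\<theta>\<in>\<Theta>. \<Sum>i\<in>I. \<delta> * (1 - ?P i \<theta>))"
    by (rule sum.swap)
  also have "\<dots> \<le> (\<Sum>\<theta>\<in>\<Theta>. risk n p r Vh (V \<theta>) (\<lambda>_. lmb))"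
    by (intro sum_mono risk)
  finally have avg: "real (card I) * (\<delta> / 4) * real (card \<Theta>) \<le> (\<Sum>\<theta>\<in>\<Theta>. risk n p r Vh (V \<theta>) (\<lambda>_. lmb))" .
  show ?thesis
  proof (rule ccontr)
    assume "\<not> ?thesis"
    then have "(\<Sum>\<theta>\<in>\<Theta>. risk n p r Vh (V \<theta>) (\<lambda>_. lmb)) < (\<Sum>\<theta>\<in>\<Theta>. real (card I) * \<eta>\<^sup>2 / 64)"
      using \<Theta> by (intro sum_strict_mono) (auto simp: \<Theta>_def not_le)
    then show False using avg by (simp add: \<delta>_def mult.commute)
  qed
qed

subsection \<open>The two families of hypotheses\<close>

text \<open>An arbitrary choice is harmless, because the projection depends only on the column
  space.\<close>

definition graph_rep :: "nat \<Rightarrow> nat \<Rightarrow> (nat \<Rightarrow> nat \<Rightarrow> real) \<Rightarrow> nat \<Rightarrow> nat \<Rightarrow> real" where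
  "graph_rep p r M = (SOME V. graph_frame p r M V)"

lemma graph_frame_rep: "r \<le> p \<Longrightarrow> graph_frame p r M (graph_rep p r M)"
  unfolding graph_rep_def using graph_frame_exists by (rule someI_ex)

lemma frob2_le_card:
  assumes S: "finite S" and c: "0 \<le> c"
    and le: "\<And>i j. r \<le> i \<Longrightarrow> i < p \<Longrightarrow> j < r \<Longrightarrow> (M i j)\<^sup>2 \<le> c"
    and supp: "\<And>i j. r \<le> i \<Longrightarrow> i < p \<Longrightarrow> j < r \<Longrightarrow> (i, j) \<notin> S \<Longrightarrow> M i j = 0"
  shows "frob2 p r M \<le> real (card S) * c"
proof -
  let ?T = "{r..<p} \<times> {..<r}"
  have "frob2 p r M = (\<Sum>e\<in>?T. (M (fst e) (snd e))\<^sup>2)"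
    by (simp add: frob2_def sum.cartesian_product')
  also have "\<dots> = (\<Sum>e\<in>?T \<inter> S. (M (fst e) (snd e))\<^sup>2)"
  proof (rule sum.mono_neutral_right)
    show "\<forall>e\<in>?T - ?T \<inter> S. (M (fst e) (snd e))\<^sup>2 = 0"
    proof
      fix e assume "e \<in> ?T - ?T \<inter> S"
      then show "(M (fst e) (snd e))\<^sup>2 = 0" using supp[of "fst e" "snd e"] by auto
    qed
  qed auto
  also have "\<dots> \<le> (\<Sum>e\<in>?T \<inter> S. c)"
    using le by (intro sum_mono) auto
  also have "\<dots> \<le> real (card S) * c"
    using S c by (simp add: mult_right_mono card_mono)
  finally show ?thesis .
qed

text \<open>With all spikes equal to lmb, the spread condition only asks that lmb \<le> \<kappa>
  lmb.\<close>

lemma graph_rep_in_Theta0: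
  assumes "r \<le> s" "s \<le> p" "0 < lmb" "1 < \<kappa>"
    and "card {i. r \<le> i \<and> i < p \<and> (\<exists>j<r. M i j \<noteq> 0)} \<le> s - r"
  shows "(graph_rep p r M, \<lambda>_. lmb) \<in> Theta0 \<kappa> s p r lmb"
proof -
  have G: "graph_frame p r M (graph_rep p r M)" using assms by (intro graph_frame_rep) simp
  have "nz_rows p r (graph_rep p r M) \<le> s"
    using graph_frame_nz_rows[OF G] assms by linarith
  moreover have "lmb \<le> \<kappa> * lmb" using assms by simp
  ultimately show ?thesis using graph_frame_orth[OF G] by (simp add: Theta0_def)
qed

lemma graph_rep_relative_entropy_le:
  assumes "r \<le> p" "0 < lmb" "frob2 p r (\<lambda>i j. M' i j - M i j) \<le> c"
  shows "real n * hfun lmb / 4 * proj_dist2 p r (graph_rep p r M) (graph_rep p r M') \<le> real n * hfun lmb / 2 * c"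
proof -
  have "proj_dist2 p r (graph_rep p r M) (graph_rep p r M') \<le> 2 * c"
    using graph_frame_dist_le[OF assms(1) graph_frame_rep[OF assms(1)] graph_frame_rep[OF assms(1)], of M M'] assms(3)
    by linarith
  then have "real n * hfun lmb / 4 * proj_dist2 p r (graph_rep p r M) (graph_rep p r M')
      \<le> real n * hfun lmb / 4 * (2 * c)"
    using assms(2) by (intro mult_left_mono) (auto simp: hfun_def)
  then show ?thesis by (simp add: algebra_simps)
qed

text \<open>Supplies numerical lower bounds for logarithms, such as ln 256 \<ge> 4 from 3^4 =
  81.\<close>

lemma exp_le_3_power: "exp (real k) \<le> 3 ^ k"
proof -
  have "exp (real k) = exp 1 ^ k" by (simp add: exp_of_nat_mult[symmetric])
  also have "\<dots> \<le> 3 ^ k" by (intro power_mono exp_le) simp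
  finally show ?thesis .
qed

lemma hfun_pos: "0 < lmb \<Longrightarrow> 0 < hfun lmb"
  by (simp add: hfun_def)

text \<open>Each coordinate is one entry of M, a multiple of \<eta> between 0 and 1023. With B =
  1024 one has ln (B / 4) = ln 256 \<ge> 4, which is what the test requires for K = 1; the long grid
  costs only a constant factor.\<close>

lemma dense_lower_bound:
  assumes r: "1 \<le> r" "r < s" and s: "s \<le> p" and n: "1 \<le> n" and lmb: "0 < lmb" and \<kappa>: "1 < \<kappa>"
    and Vh: "Vh \<in> estimators n p r"
  shows "\<exists>V. (V, \<lambda>_. lmb) \<in> Theta0 \<kappa> s p r lmb \<and>
    1 / 2 ^ 32 * min (real r * real (s - r) / (real n * hfun lmb)) 1 \<le> risk n p r Vh V (\<lambda>_. lmb)"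
proof -
  define N where "N = real n * hfun lmb"
  \<comment> \<open>E is the squared grid step. Grid values stay below 1024 = 2^10, so the cap 1 / N
    keeps the relative entropy along a coordinate below 2^-26 2^20 / 2, and the other cap keeps
    |M|^2 below 2^-26 2^20 = 1/64.\<close>
  define E where "E = 1 / 2 ^ 26 * min (1 / N) (1 / (real r * real (s - r)))"
  define \<eta> where "\<eta> = sqrt E"
  define I where "I = {r..<s} \<times> {..<r}"
  define M where "M \<theta> i j = (if (i, j) \<in> I then \<eta> * real (\<theta> (i, j)) else 0)" for \<theta> :: "nat \<times> nat \<Rightarrow> nat" and i j
  have rp: "r \<le> p" using r s by simp
  have N: "N > 0" using n hfun_pos[OF lmb] by (simp add: N_def)
  have m: "real r * real (s - r) > 0" using r by simp
  have E: "E > 0" "N * E \<le> 1 / 2 ^ 26" "real r * real (s - r) * E \<le> 1 / 2 ^ 26"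
    "real r * real (s - r) * E = 1 / 2 ^ 26 * min (real r * real (s - r) / N) 1"
  proof -
    show "E > 0" unfolding E_def using N m by (simp add: min_less_iff_conj del: of_nat_diff)
    have "N * E \<le> N * (1 / 2 ^ 26 * (1 / N))"
      unfolding E_def using N by (intro mult_left_mono) auto
    then show "N * E \<le> 1 / 2 ^ 26" using N by simp
    show *: "real r * real (s - r) * E = 1 / 2 ^ 26 * min (real r * real (s - r) / N) 1"
    proof -
      define w where "w = real r * real (s - r)"
      have "w * min (1 / N) (1 / w) = min (w / N) 1"
        using m by (simp add: w_def[symmetric] min_mult_distrib_left)
      then show ?thesis unfolding E_def w_def[symmetric] by simp
    qed
    show "real r * real (s - r) * E \<le> 1 / 2 ^ 26" unfolding * by simp
  qed
  have \<eta>: "\<eta> > 0" "\<eta>\<^sup>2 = E" using E by (auto simp: \<eta>_def)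
  have fin: "finite I" "real (card I) = real r * real (s - r)" by (auto simp: I_def)
  have upd: "\<theta>(e := b) \<in> I \<rightarrow>\<^sub>E {..<1024}" if "\<theta> \<in> I \<rightarrow>\<^sub>E {..<1024}" "e \<in> I" "b < 1024"
    for \<theta> :: "nat \<times> nat \<Rightarrow> nat" and e b
    using PiE_fun_upd[of b "\<lambda>_. {..<1024::nat}" e \<theta> I] that by (simp add: insert_absorb)
  have norm: "frob2 p r (M \<theta>) \<le> 1 / 64" if \<theta>: "\<theta> \<in> I \<rightarrow>\<^sub>E {..<1024}" for \<theta>
  proof -
    have "frob2 p r (M \<theta>) \<le> real (card I) * (2 ^ 20 * E)"
    proof (rule frob2_le_card)
      fix i j
      show "(M \<theta> i j)\<^sup>2 \<le> 2 ^ 20 * E"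
      proof (cases "(i, j) \<in> I")
        case True
        then have "real (\<theta> (i, j)) \<le> 1024" using PiE_mem[OF \<theta> True] by simp
        then have "(real (\<theta> (i, j)))\<^sup>2 \<le> 1024\<^sup>2" by (intro power_mono) auto
        then have "E * (real (\<theta> (i, j)))\<^sup>2 \<le> E * 2 ^ 20" using E by simp
        then show ?thesis using True by (simp add: M_def power_mult_distrib \<eta> mult.commute)
      qed (use E in \<open>simp add: M_def\<close>)
    qed (use E fin in \<open>auto simp: M_def\<close>)
    also have "\<dots> = 2 ^ 20 * (real r * real (s - r) * E)" by (simp add: fin)
    also have "\<dots> \<le> 2 ^ 20 * (1 / 2 ^ 26)" by (intro mult_left_mono E(3)) simp
    finally show ?thesis by simp
  qed
  have diff: "frob2 p r (\<lambda>i j. M (\<theta>(e := b')) i j - M (\<theta>(e := b)) i j) \<le> (\<eta> * \<bar>real b' - real b\<bar>)\<^sup>2"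
    if "e \<in> I" for \<theta> e b b'
  proof -
    have eq: "M (\<theta>(e := b')) i j - M (\<theta>(e := b)) i j = (if (i, j) = e then \<eta> * (real b' - real b) else 0)" for i j
      using that by (auto simp: M_def right_diff_distrib)
    have "frob2 p r (\<lambda>i j. M (\<theta>(e := b')) i j - M (\<theta>(e := b)) i j) \<le> real (card {e}) * (\<eta> * \<bar>real b' - real b\<bar>)\<^sup>2"
      unfolding eq by (rule frob2_le_card) (auto simp: power_mult_distrib)
    then show ?thesis by simp
  qed
  have "\<exists>\<theta>\<in>I \<rightarrow>\<^sub>E {..<1024}. real (card I) * \<eta>\<^sup>2 / 64 \<le> risk n p r Vh (graph_rep p r (M \<theta>)) (\<lambda>_. lmb)"
  proof (rule spiked_assouad[where J = "\<lambda>e. {e}" and K = 1])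
    show "\<And>i. i \<in> I \<Longrightarrow> {i} \<subseteq> {..<p} \<times> {..<p}" using s by (auto simp: I_def)
    show "disjoint_family_on (\<lambda>e. {e}) I" by (simp add: disjoint_family_on_def)
    show "orth_frame p r (graph_rep p r (M \<theta>))" for \<theta>
      by (rule graph_frame_orth[OF graph_frame_rep[OF rp]])
  next
    fix \<theta> :: "nat \<times> nat \<Rightarrow> nat" and e and b :: nat assume e: "e \<in> I" and b: "b < 1024"
    have "real n * hfun lmb / 4 * proj_dist2 p r (graph_rep p r (M (\<theta>(e := b)))) (graph_rep p r (M (\<theta>(e := 0))))
      \<le> real n * hfun lmb / 2 * (\<eta> * \<bar>real 0 - real b\<bar>)\<^sup>2"
      by (rule graph_rep_relative_entropy_le[OF rp lmb diff[OF e]])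
    also have "\<dots> = (N * E) * (real b)\<^sup>2 / 2" by (simp add: N_def power_mult_distrib \<eta>)
    also have "\<dots> \<le> 1 / 2 ^ 26 * 1024\<^sup>2 / 2"
      using b by (intro divide_right_mono mult_mono E(2) power_mono) auto
    also have "\<dots> \<le> 1" by simp
    finally show "real n * hfun lmb / 4 * proj_dist2 p r (graph_rep p r (M (\<theta>(e := b)))) (graph_rep p r (M (\<theta>(e := 0)))) \<le> 1" .
  next
    fix \<theta> :: "nat \<times> nat \<Rightarrow> nat" and e and b b' :: nat
    assume \<theta>: "\<theta> \<in> I \<rightarrow>\<^sub>E {..<1024}" and e: "e \<in> I" and b: "b < 1024" "b' < 1024" "b \<noteq> b'"
    obtain i j where ij: "e = (i, j)" "r \<le> i" "i < p" "j < r" using e s by (auto simp: I_def)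
    \<comment> \<open>Different grid points differ by at least one step. The error is a third of
      their distance, which leaves at least 2/3 of \<eta>.\<close>
    have ge1: "1 \<le> \<bar>real b - real b'\<bar>" using b by (cases "b < b'") auto
    have "\<bar>(projm r (graph_rep p r (M (\<theta>(e := b)))) i j - projm r (graph_rep p r (M (\<theta>(e := b')))) i j)
        - (M (\<theta>(e := b)) i j - M (\<theta>(e := b')) i j)\<bar> \<le> \<eta> * \<bar>real b - real b'\<bar> / 3"
      using \<eta> ij
      by (intro graph_frame_entry[OF rp graph_frame_rep[OF rp] graph_frame_rep[OF rp]] norm upd \<theta> e b diff) auto
    moreover have "M (\<theta>(e := b)) i j - M (\<theta>(e := b')) i j = \<eta> * (real b - real b')"
      using e by (simp add: M_def ij right_diff_distrib)
    moreover have "\<bar>\<eta> * (real b - real b')\<bar> = \<eta> * \<bar>real b - real b'\<bar>" using \<eta> by (simp add: abs_mult)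
    moreover have "\<eta> \<le> \<eta> * \<bar>real b - real b'\<bar>" using \<eta> ge1 by simp
    ultimately have "\<eta> / 2 \<le> \<bar>projm r (graph_rep p r (M (\<theta>(e := b)))) i j - projm r (graph_rep p r (M (\<theta>(e := b')))) i j\<bar>"
      using \<eta>(1) by linarith
    then show "\<exists>e'\<in>{e}. \<eta> / 2 \<le> \<bar>projm r (graph_rep p r (M (\<theta>(e := b)))) (fst e') (snd e')
       - projm r (graph_rep p r (M (\<theta>(e := b')))) (fst e') (snd e')\<bar>"
      by (simp add: ij)
  next
    have "4 \<le> ln (256 :: real)" using exp_le_3_power[of 4] by (simp add: ln_ge_iff)
    then show "2 * (1 + 1) \<le> ln (real 1024 / 4)" by simp
  qed (use fin Vh lmb \<eta> in auto)
  then obtain \<theta> where \<theta>: "\<theta> \<in> I \<rightarrow>\<^sub>E {..<1024}"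
    and risk: "real (card I) * \<eta>\<^sup>2 / 64 \<le> risk n p r Vh (graph_rep p r (M \<theta>)) (\<lambda>_. lmb)" by blast
  have "{i. r \<le> i \<and> i < p \<and> (\<exists>j<r. M \<theta> i j \<noteq> 0)} \<subseteq> {r..<s}" by (auto simp: M_def I_def)
  then have "card {i. r \<le> i \<and> i < p \<and> (\<exists>j<r. M \<theta> i j \<noteq> 0)} \<le> card {r..<s}" by (intro card_mono) auto
  then have "(graph_rep p r (M \<theta>), \<lambda>_. lmb) \<in> Theta0 \<kappa> s p r lmb"
    using r s lmb \<kappa> by (intro graph_rep_in_Theta0) auto
  \<comment> \<open>The constant is 2^-26 from E times 1/64 from Assouad's scheme.\<close>
  moreover have "real (card I) * \<eta>\<^sup>2 / 64 = 1 / 2 ^ 32 * min (real r * real (s - r) / N) 1"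
    unfolding fin \<eta> E(4) by simp
  ultimately show ?thesis using risk unfolding N_def by auto
qed

text \<open>A coordinate is the position of the nonzero entry inside its block, so it has B values
  although changing it alters only two entries of M. The allowed relative entropy ln B / 8 thus
  exceeds that of a binary choice by the logarithmic factor.\<close>

lemma sparse_lower_bound:
  assumes r: "1 \<le> r" "r < s" and s: "s \<le> p" and n: "1 \<le> n" and lmb: "0 < lmb" and \<kappa>: "1 < \<kappa>"
    and Vh: "Vh \<in> estimators n p r"
    and B: "1024 \<le> B" "(s - r) * B \<le> p - r"
  shows "\<exists>V. (V, \<lambda>_. lmb) \<in> Theta0 \<kappa> s p r lmb \<and>
    1 / 2 ^ 12 * min (real (s - r) * ln (real B) / (real n * hfun lmb)) 1 \<le> risk n p r Vh V (\<lambda>_. lmb)"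
proof -
  define N where "N = real n * hfun lmb"
  define m where "m = s - r"
  \<comment> \<open>The first cap bounds the relative entropy N E of a move by ln B / 8; the second
    gives |M|^2 \<le> m E \<le> 1/64 for the m nonzero entries.\<close>
  define E where "E = min (ln (real B) / (8 * N)) (1 / (64 * real m))"
  define \<eta> where "\<eta> = sqrt E"
  \<comment> \<open>Block k occupies the B consecutive rows from r + kB on; the assumption on B
    makes all m blocks fit below p.\<close>
  define row where "row k b = r + k * B + b" for k b
  define R where "R \<theta> = (\<lambda>k. row k (\<theta> k)) ` {..<m}" for \<theta>
  define M where "M \<theta> i j = (if j = 0 \<and> i \<in> R \<theta> then \<eta> else 0)" for \<theta> and i j :: nat
  have rp: "r \<le> p" using r s by simp
  have N: "N > 0" using n hfun_pos[OF lmb] by (simp add: N_def)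
  have m: "0 < m" using r by (simp add: m_def)
  have lnB: "6 \<le> ln (real B)" using exp_le_3_power[of 6] B(1) by (simp add: ln_ge_iff)
  have E: "E > 0" "N * E \<le> ln (real B) / 8" "real m * E \<le> 1 / 64"
  proof -
    show "E > 0" using N m lnB by (simp add: E_def)
    have "N * E \<le> N * (ln (real B) / (8 * N))"
      unfolding E_def using N by (intro mult_left_mono) auto
    then show "N * E \<le> ln (real B) / 8" using N by simp
    have "real m * E \<le> real m * (1 / (64 * real m))"
      unfolding E_def by (intro mult_left_mono) auto
    then show "real m * E \<le> 1 / 64" using m by simp
  qed
  \<comment> \<open>In either branch of the minimum, m E is at least 1/64 of the target; Assouad's
    factor 1/64 completes 2^-12.\<close>
  have mE: "1 / 2 ^ 12 * min (real m * ln (real B) / N) 1 \<le> real m * E / 64"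
  proof -
    have "1 / 64 * min (real m * ln (real B) / N) 1 \<le> real m * (ln (real B) / (8 * N))"
      "1 / 64 * min (real m * ln (real B) / N) 1 \<le> real m * (1 / (64 * real m))"
    proof -
      define y where "y = real m * ln (real B) / N"
      have "0 \<le> y" using N lnB by (simp add: y_def)
      moreover have y8: "real m * (ln (real B) / (8 * N)) = y / 8" by (simp add: y_def)
      ultimately show "1 / 64 * min (real m * ln (real B) / N) 1 \<le> real m * (ln (real B) / (8 * N))"
        unfolding y8 y_def[symmetric] by (auto simp: min_def)
      show "1 / 64 * min (real m * ln (real B) / N) 1 \<le> real m * (1 / (64 * real m))"
        using m by simp
    qed
    moreover have "E = ln (real B) / (8 * N) \<or> E = 1 / (64 * real m)" by (auto simp: E_def min_def)
    ultimately have "1 / 64 * min (real m * ln (real B) / N) 1 \<le> real m * E" by (elim disjE) (simp_all only:)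
    then show ?thesis by simp
  qed
  have \<eta>: "\<eta> > 0" "\<eta>\<^sup>2 = E" using E by (auto simp: \<eta>_def)
  have row_inj: "k = k' \<and> b = b'" if "row k b = row k' b'" "b < B" "b' < B" for k k' b b'
  proof -
    have eq: "k * B + b = k' * B + b'" using that(1) by (simp add: row_def)
    have "(k * B + b) div B = k" "(k' * B + b') div B = k'" using that(2,3) by simp_all
    then have "k = k'" using eq by simp
    then show ?thesis using eq by simp
  qed
  have row_less: "row k b < p" if "k < m" "b < B" for k b
  proof -
    have "row k b < r + (k + 1) * B" using that by (simp add: row_def)
    also have "\<dots> \<le> r + m * B" using that by (intro add_left_mono mult_right_mono) auto
    also have "\<dots> \<le> p" using B rp by (simp add: m_def)
    finally show ?thesis .
  qed
  have upd: "\<theta>(k := b) \<in> {..<m} \<rightarrow>\<^sub>E {..<B}" if "\<theta> \<in> {..<m} \<rightarrow>\<^sub>E {..<B}" "k < m" "b < B" for \<theta> k b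
    using PiE_fun_upd[of b "\<lambda>_. {..<B}" k \<theta> "{..<m}"] that by (simp add: insert_absorb)
  have cardR: "finite (R \<theta>)" "card (R \<theta>) \<le> m" for \<theta>
    using card_image_le[of "{..<m}" "\<lambda>k. row k (\<theta> k)"] by (auto simp: R_def)
  have norm: "frob2 p r (M \<theta>) \<le> 1 / 64" for \<theta>
  proof -
    have "frob2 p r (M \<theta>) \<le> real (card (R \<theta> \<times> {0::nat})) * E"
      by (rule frob2_le_card) (use E cardR in \<open>auto simp: M_def \<eta>\<close>)
    also have "\<dots> \<le> real m * E"
      using cardR[of \<theta>] E by (intro mult_right_mono) (auto simp: card_cartesian_product)
    finally show ?thesis using E by simp
  qed
  have diff: "frob2 p r (\<lambda>i j. M (\<theta>(k := b')) i j - M (\<theta>(k := b)) i j) \<le> 2 * E" for \<theta> k b b'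
  proof -
    have "frob2 p r (\<lambda>i j. M (\<theta>(k := b')) i j - M (\<theta>(k := b)) i j) \<le> real (card {(row k b, 0::nat), (row k b', 0)}) * E"
    proof (rule frob2_le_card)
      fix i j assume "(i, j) \<notin> {(row k b, 0::nat), (row k b', 0)}"
      then show "M (\<theta>(k := b')) i j - M (\<theta>(k := b)) i j = 0"
        by (auto simp: M_def R_def split: if_splits)
    qed (use E in \<open>auto simp: M_def \<eta>\<close>)
    also have "\<dots> \<le> real 2 * E"
      using E by (intro mult_right_mono) (auto simp: card_insert_if)
    finally show ?thesis by simp
  qed
  have "\<exists>\<theta>\<in>{..<m} \<rightarrow>\<^sub>E {..<B}. real (card {..<m}) * \<eta>\<^sup>2 / 64 \<le> risk n p r Vh (graph_rep p r (M \<theta>)) (\<lambda>_. lmb)"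
  proof (rule spiked_assouad[where J = "\<lambda>k. (\<lambda>b. (row k b, 0)) ` {..<B}" and K = "ln (real B) / 8"])
    show "(\<lambda>b. (row k b, 0)) ` {..<B} \<subseteq> {..<p} \<times> {..<p}" if "k \<in> {..<m}" for k
      using that row_less r rp by auto
    show "disjoint_family_on (\<lambda>k. (\<lambda>b. (row k b, 0::nat)) ` {..<B}) {..<m}"
      unfolding disjoint_family_on_def
    proof (intro ballI impI)
      fix k k' :: nat assume "k \<noteq> k'"
      then have "row k b \<noteq> row k' b'" if "b < B" "b' < B" for b b' using row_inj that by blast
      then show "(\<lambda>b. (row k b, 0::nat)) ` {..<B} \<inter> (\<lambda>b. (row k' b, 0::nat)) ` {..<B} = {}" by auto
    qed
    show "orth_frame p r (graph_rep p r (M \<theta>))" for \<theta>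
      by (rule graph_frame_orth[OF graph_frame_rep[OF rp]])
  next
    fix \<theta> :: "nat \<Rightarrow> nat" and k b
    have "real n * hfun lmb / 4 * proj_dist2 p r (graph_rep p r (M (\<theta>(k := b)))) (graph_rep p r (M (\<theta>(k := 0))))
      \<le> real n * hfun lmb / 2 * (2 * E)"
      by (rule graph_rep_relative_entropy_le[OF rp lmb diff])
    also have "\<dots> = N * E" by (simp add: N_def)
    also have "\<dots> \<le> ln (real B) / 8" by (rule E(2))
    finally show "real n * hfun lmb / 4 * proj_dist2 p r (graph_rep p r (M (\<theta>(k := b)))) (graph_rep p r (M (\<theta>(k := 0))))
      \<le> ln (real B) / 8" .
  next
    fix \<theta> k b b'
    assume \<theta>: "\<theta> \<in> {..<m} \<rightarrow>\<^sub>E {..<B}" and k: "k \<in> {..<m}" and b: "b < B" "b' < B" "b \<noteq> b'"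
    \<comment> \<open>Taking d = 3/2 \<eta> makes the error d / 3 = \<eta> / 2, exactly half of the
      jump \<eta> of M at this entry. This is what fixes the separation \<eta> / 2 in
      \<open>spiked_assouad\<close>.\<close>
    have "2 * E \<le> (3 / 2 * \<eta>)\<^sup>2" using E by (simp add: power_mult_distrib \<eta> power_divide)
    then have "\<bar>(projm r (graph_rep p r (M (\<theta>(k := b)))) (row k b) 0 - projm r (graph_rep p r (M (\<theta>(k := b')))) (row k b) 0)
        - (M (\<theta>(k := b)) (row k b) 0 - M (\<theta>(k := b')) (row k b) 0)\<bar> \<le> 3 / 2 * \<eta> / 3"
      using \<eta> r k row_less[of k b] b
      by (intro graph_frame_entry[OF rp graph_frame_rep[OF rp] graph_frame_rep[OF rp]] norm order_trans[OF diff])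
         (auto simp: row_def)
    moreover have "M (\<theta>(k := b)) (row k b) 0 = \<eta>"
      using k by (auto simp: M_def R_def)
    moreover have "M (\<theta>(k := b')) (row k b) 0 = 0"
    proof -
      have "row k b \<noteq> row k' ((\<theta>(k := b')) k')" if "k' < m" for k'
        using row_inj[of k b k' "(\<theta>(k := b')) k'"] PiE_mem[OF upd[OF \<theta> _ b(2), of k], of k'] that k b by auto
      then show ?thesis by (auto simp: M_def R_def)
    qed
    ultimately have "\<eta> / 2 \<le> \<bar>projm r (graph_rep p r (M (\<theta>(k := b)))) (row k b) 0 - projm r (graph_rep p r (M (\<theta>(k := b')))) (row k b) 0\<bar>"
      using \<eta>(1) by linarith
    then show "\<exists>e\<in>(\<lambda>b. (row k b, 0)) ` {..<B}. \<eta> / 2 \<le> \<bar>projm r (graph_rep p r (M (\<theta>(k := b)))) (fst e) (snd e)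
       - projm r (graph_rep p r (M (\<theta>(k := b')))) (fst e) (snd e)\<bar>"
      using b by (intro bexI[of _ "(row k b, 0)"]) auto
  next
    \<comment> \<open>It then suffices that 3/4 ln B \<ge> 4, and ln B \<ge> 6.\<close>
    have "ln 4 \<le> (2::real)" using ln_le_minus_one[of 2] ln_realpow[of 2 2] by simp
    moreover have "ln (real B / 4) = ln (real B) - ln 4" using B by (simp add: ln_div)
    ultimately have "2 * (ln (real B) / 8 + 1) \<le> ln (real B) - ln 4" "ln (real B / 4) = ln (real B) - ln 4"
      using lnB by auto
    then show "2 * (ln (real B) / 8 + 1) \<le> ln (real B / 4)" by simp
  qed (use Vh lmb \<eta> B lnB in auto)
  then obtain \<theta> where \<theta>: "\<theta> \<in> {..<m} \<rightarrow>\<^sub>E {..<B}"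
    and risk: "real (card {..<m}) * \<eta>\<^sup>2 / 64 \<le> risk n p r Vh (graph_rep p r (M \<theta>)) (\<lambda>_. lmb)" by blast
  have "{i. r \<le> i \<and> i < p \<and> (\<exists>j<r. M \<theta> i j \<noteq> 0)} \<subseteq> R \<theta>" by (auto simp: M_def)
  then have "card {i. r \<le> i \<and> i < p \<and> (\<exists>j<r. M \<theta> i j \<noteq> 0)} \<le> card (R \<theta>)" by (intro card_mono cardR)
  also have "\<dots> \<le> s - r" using cardR m_def by simp
  finally have "(graph_rep p r (M \<theta>), \<lambda>_. lmb) \<in> Theta0 \<kappa> s p r lmb"
    using r s lmb \<kappa> by (intro graph_rep_in_Theta0) auto
  moreover have "1 / 2 ^ 12 * min (real m * ln (real B) / N) 1 \<le> risk n p r Vh (graph_rep p r (M \<theta>)) (\<lambda>_. lmb)"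
    using risk mE by (simp add: \<eta>)
  ultimately show ?thesis unfolding N_def m_def by auto
qed

section \<open>From the two families to the minimax risk\<close>

lemma risk_le_SUP:
  assumes "Vh \<in> estimators n p r" "(V, lam) \<in> Theta0 \<kappa> s p r lmb"
  shows "risk n p r Vh V lam \<le> (SUP \<theta>\<in>Theta0 \<kappa> s p r lmb. risk n p r Vh (fst \<theta>) (snd \<theta>))"
proof -
  have "bdd_above ((\<lambda>\<theta>. risk n p r Vh (fst \<theta>) (snd \<theta>)) ` Theta0 \<kappa> s p r lmb)"
    by (rule bdd_aboveI2[where M = "4 * (real p)\<^sup>2"]) (auto simp: Theta0_def intro!: risk_le assms(1))
  from cSUP_upper[OF assms(2) this] show ?thesis by simp
qed

lemma estimators_nonempty: "r \<le> p \<Longrightarrow> estimators n p r \<noteq> {}"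
  using graph_frame_orth[OF graph_frame_rep[of r p "\<lambda>_ _. 0"]]
  by (auto simp: estimators_def intro!: exI[of _ "\<lambda>_. graph_rep p r (\<lambda>_ _. 0)"])

lemma min_add_le:
  fixes x y z N :: real
  assumes "0 < N" "x \<le> a * y" "1 \<le> a"
  shows "min (x / N) 1 \<le> a * min (y / N) 1"
proof -
  have "x / N \<le> a * (y / N)" using assms by (simp add: divide_right_mono)
  then have "min (x / N) 1 \<le> min (a * (y / N)) a" using assms by (intro min.mono) auto
  also have "\<dots> = a * min (y / N) 1" using assms by (simp add: min_mult_distrib_left)
  finally show ?thesis .
qed

text \<open>The sum of the two rates is at most a constant times the larger one, once the logarithm
  of the real quotient q has been compared with that of the integer block length B.\<close>

lemma spiked_sup_risk_lower_bound:
  assumes r: "1 \<le> r" "r < s" and s: "s \<le> p" and n: "1 \<le> n" and lmb: "0 < lmb" and \<kappa>: "1 < \<kappa>"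
    and Vh: "Vh \<in> estimators n p r"
  shows "1 / 2 ^ 36 * min (1 / (real n * hfun lmb) * (real r * real (s - r) +
      real (s - r) * ln (exp 1 * real (p - r) / real (s - r)))) 1
    \<le> (SUP \<theta>\<in>Theta0 \<kappa> s p r lmb. risk n p r Vh (fst \<theta>) (snd \<theta>))" (is "_ * min (_ * ?T) 1 \<le> ?S")
proof -
  define N where "N = real n * hfun lmb"
  define m where "m = s - r"
  define q where "q = real (p - r) / real m"
  define B where "B = (p - r) div m"
  have N: "N > 0" using n hfun_pos[OF lmb] by (simp add: N_def)
  have m: "0 < m" "m \<le> p - r" using r s by (auto simp: m_def)
  have q1: "1 \<le> q" using m by (simp add: q_def)
  have qB: "q < real B + 1"
  proof -
    have "p - r = B * m + (p - r) mod m" by (simp add: B_def)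
    also have "\<dots> < B * m + m" using m by simp
    finally have "real (p - r) < (real B + 1) * real m"
      by (simp add: distrib_right flip: of_nat_mult of_nat_add)
    then show ?thesis using m by (simp add: q_def field_simps)
  qed
  have "exp 1 * real (p - r) / real m = exp 1 * q" by (simp add: q_def)
  also have "ln (exp 1 * q) = 1 + ln q" using q1 by (simp add: ln_mult_pos)
  finally have T: "?T = real r * real m + real m * (1 + ln q)" by (simp add: m_def)
  have dense: "1 / 2 ^ 32 * min (real r * real m / N) 1 \<le> ?S"
    using dense_lower_bound[OF r s n lmb \<kappa> Vh] risk_le_SUP[OF Vh] unfolding N_def m_def
    by (meson order_trans)
  have rm: "real m \<le> real r * real m" using r mult_right_mono[of 1 "real r" "real m"] by simp
  \<comment> \<open>The gap between 2^-32 and 2^-36 absorbs every factor up to 16; the cases below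
    use 12 and 3.\<close>
  have combine: "1 / 2 ^ 36 * x \<le> ?S" if "x \<le> a * y" "0 \<le> y" "1 / 2 ^ 32 * y \<le> ?S" "a \<le> 16" for x y a
  proof -
    have "1 / 2 ^ 36 * x \<le> 1 / 2 ^ 36 * (16 * y)"
      using that mult_right_mono[of a 16 y] by (intro mult_left_mono) auto
    also have "\<dots> = 1 / 2 ^ 32 * y" by simp
    finally show ?thesis using that(3) by (rule order_trans)
  qed
  have "1 / 2 ^ 36 * min (?T / N) 1 \<le> ?S"
  proof (cases "1024 \<le> B")
    \<comment> \<open>Short blocks: q < B + 1 \<le> 1024 gives 1 + ln q \<le> 11, so the logarithmic
      term is at most 11 times the dense one.\<close>
    case False
    then have "q \<le> 2 ^ 10" using qB by simp
    then have "ln q \<le> ln (2 ^ 10)" using q1 by simp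
    also have "\<dots> \<le> 10" using ln_le_minus_one[of 2] by (simp add: ln_realpow del: power_numeral)
    finally have "real m * (1 + ln q) \<le> real m * 11" by (intro mult_left_mono) auto
    then have "?T \<le> 12 * (real r * real m)" unfolding T using rm by linarith
    then have "min (?T / N) 1 \<le> 12 * min (real r * real m / N) 1" using N by (intro min_add_le) auto
    then show ?thesis by (rule combine[OF _ _ dense]) (use N in auto)
  next
    case True
    have "m * B \<le> p - r" by (simp add: B_def)
    then have "1 / 2 ^ 12 * min (real m * ln (real B) / N) 1 \<le> ?S"
      using sparse_lower_bound[OF r s n lmb \<kappa> Vh True] risk_le_SUP[OF Vh] unfolding N_def m_def
      by (meson order_trans)
    moreover have lnB: "2 \<le> ln (real B)" using exp_le_3_power[of 2] True by (simp add: ln_ge_iff)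
    have nonneg: "0 \<le> min (real m * ln (real B) / N) 1" using N lnB by simp
    have "1 / 2 ^ 32 * min (real m * ln (real B) / N) 1 \<le> 1 / 2 ^ 12 * min (real m * ln (real B) / N) 1"
      by (rule mult_right_mono[OF _ nonneg]) simp
    ultimately have sparse: "1 / 2 ^ 32 * min (real m * ln (real B) / N) 1 \<le> ?S"
      by linarith
    \<comment> \<open>Rounding down loses at most a factor 2, since q < B + 1 \<le> 2B, and ln 2
      \<le> 1.\<close>
    have "ln q \<le> ln (2 * real B)" using q1 qB True by simp
    also have "\<dots> \<le> 1 + ln (real B)" using ln_le_minus_one[of 2] True by (simp add: ln_mult)
    finally have "1 + ln q \<le> 2 * ln (real B)" using lnB by linarith
    then have "real m * (1 + ln q) \<le> real m * (2 * ln (real B))" by (intro mult_left_mono) auto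
    then have T': "?T \<le> real r * real m + 2 * (real m * ln (real B))" unfolding T by linarith
    show ?thesis
    proof (cases "real r * real m \<le> real m * ln (real B)")
      case True
      then have "?T \<le> 3 * (real m * ln (real B))" using T' by linarith
      then have "min (?T / N) 1 \<le> 3 * min (real m * ln (real B) / N) 1" using N by (intro min_add_le) auto
      then show ?thesis by (rule combine[OF _ nonneg sparse]) simp
    next
      case False
      then have "?T \<le> 3 * (real r * real m)" using T' by linarith
      then have "min (?T / N) 1 \<le> 3 * min (real r * real m / N) 1" using N by (intro min_add_le) auto
      then show ?thesis by (rule combine[OF _ _ dense]) (use N in auto)
    qed
  qed
  then show ?thesis by (simp add: N_def)
qed

theorem theorem3:
  "\<exists>c>0. \<forall>\<kappa>>1. \<forall>(p::nat) (s::nat) (r::nat) (n::nat) (lmb::real).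
     1 \<le> r \<longrightarrow> r \<le> s \<longrightarrow> s \<le> p \<longrightarrow> 1 \<le> n \<longrightarrow> 0 < lmb \<longrightarrow>
     (INF Vh\<in>estimators n p r. SUP \<theta>\<in>Theta0 \<kappa> s p r lmb. risk n p r Vh (fst \<theta>) (snd \<theta>))
       \<ge> c * min (1 / (real n * hfun lmb) *
                    (real r * real (s - r) +
                     (if s = r then 0
                      else real (s - r) * ln (exp 1 * real (p - r) / real (s - r))))) 1"
proof (intro exI[of _ "1 / 2 ^ 36"] conjI allI impI)
  fix \<kappa> lmb :: real and p s r n :: nat
  assume \<kappa>: "1 < \<kappa>" and r: "1 \<le> r" "r \<le> s" and s: "s \<le> p" and n: "1 \<le> n" and lmb: "0 < lmb"
  show "1 / 2 ^ 36 * min (1 / (real n * hfun lmb) * (real r * real (s - r) +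
       (if s = r then 0 else real (s - r) * ln (exp 1 * real (p - r) / real (s - r))))) 1
     \<le> (INF Vh\<in>estimators n p r. SUP \<theta>\<in>Theta0 \<kappa> s p r lmb. risk n p r Vh (fst \<theta>) (snd \<theta>))"
  proof (rule cINF_greatest)
    show "estimators n p r \<noteq> {}" using r s by (intro estimators_nonempty) simp
  next
    fix Vh assume Vh: "Vh \<in> estimators n p r"
    show "1 / 2 ^ 36 * min (1 / (real n * hfun lmb) * (real r * real (s - r) +
       (if s = r then 0 else real (s - r) * ln (exp 1 * real (p - r) / real (s - r))))) 1
     \<le> (SUP \<theta>\<in>Theta0 \<kappa> s p r lmb. risk n p r Vh (fst \<theta>) (snd \<theta>))"
    proof (cases "s = r")
      case True
      \<comment> \<open>The claimed bound is 0 here. A member of the parameter space is still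
        required, since nonnegativity of the supremum is read off from its risk.\<close>
      have "(graph_rep p r (\<lambda>_ _. 0), \<lambda>_. lmb) \<in> Theta0 \<kappa> s p r lmb"
        using r s lmb \<kappa> by (intro graph_rep_in_Theta0) auto
      from order_trans[OF risk_nonneg risk_le_SUP[OF Vh this]]
      show ?thesis using True by simp
    next
      case False
      then show ?thesis using spiked_sup_risk_lower_bound[OF r(1) _ s n lmb \<kappa> Vh] r(2) by simp
    qed
  qed
qed simp

end
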